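(* Let $\mu$ be a boundedly supported probability measure on $\mathrm{GL}_d(\mathbb{C})$ such that the semigroup generated by the support $S$ of $\mu$ is strongly irreducible and proximal. Let $\kappa_S:=\sup\{\max(\ln\|g\|,\ln\|g^{-1}\|):g\in S\}$ and $\mathfrak{c}=\mathfrak{c}(\mu^* )$. Then, for every $t>0$ and $n\in\mathbb{N}$, we have $$\sup_{v\in\mathbb{C}^d\setminus\{0\}}\mathbb{P}\left(\left|\ln\frac{\|R_nv\|}{\|v\|}-n\ell(\mu)\right|\geq nt\right)\leq 2\exp\left(-\frac{nt^2}{32(\kappa_S+\mathfrak{c})^2}\right).$$ In particular, for every $t>0$ and $n\in\mathbb{N}$ such that $nt\geq\ln d$, the following holds: $$\mathbb{P}\left(\left|\ln\|R_n\|-n\ell(\mu)\right|\geq nt\right)\leq 2d\exp\left(-\frac{nt^2}{128(\kappa_S+\mathfrak{c})^2}\right).$$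
   Context: $\mathbb{C}^d$ carries its canonical Hermitian structure; $\|\cdot\|$ denotes the norm on $\mathbb{C}^d$ and the operator norm on $M_d(\mathbb{C})$. Boundedly supported means $\kappa_S<\infty$. A semigroup is strongly irreducible if it does not preserve any finite union of non-trivial proper subspaces of $\mathbb{C}^d$; it is proximal if the closure in $M_d(\mathbb{C})$ of the set of complex multiples of its elements contains a rank-one linear transformation. $(X_i)$ are i.i.d. with law $\mu$, $R_n=X_1\cdots X_n$, and $\ell(\mu)$ is the top Lyapunov exponent, i.e. the a.s. limit of $\frac1n\ln\|R_n\|$. $\mu^*$ is the pushforward of $\mu$ by $g\mapsto g^*$ (conjugate transpose). A strongly irreducible proximal measure has a unique stationary probability measure on the projective space $P(\mathbb{C}^d)$ (a probability measure $\nu$ is $\mu$-stationary if $\iint\phi(gx)\,d\mu(g)\,d\nu(x)=\int\phi\,d\nu$ for every bounded measurable $\phi$). For such a boundedly supported measure $\eta$ with stationary measure $\nu_\eta$, $\mathfrak{c}(\eta)=\sup_{x\in\mathbb{C}^d\setminus\{0\}}\int\ln\frac{\|x\|\,\|y\|}{|\langle x,y\rangle|}\,d\nu_\eta(\mathbb{C}y)$, which is finite. *)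

theory Defs
  imports "HOL-Probability.Probability"
begin

section \<open>Matrices acting on \<open>\<complex>\<^sup>d\<close>\<close>

text \<open>The space \<open>\<complex>\<^sup>d\<close> is \<^typ>\<open>complex ^ 'd\<close>; its library norm is the Hermitian norm
  \<open>(\<Sum>\<^sub>i \<bar>x\<^sub>i\<bar>\<^sup>2)\<^sup>1\<^sup>/\<^sup>2\<close>. Complex subspaces, spans and dimensions are those of the
  interpretation \<open>vec\<close> (scalar multiplication \<open>*s\<close>), not the real ones.\<close>

definition herm :: "complex ^ 'd \<Rightarrow> complex ^ 'd \<Rightarrow> complex"
  where "herm x y = (\<Sum>i\<in>UNIV. x $ i * cnj (y $ i))"

definition conj_transpose :: "complex ^ 'd ^ 'd \<Rightarrow> complex ^ 'd ^ 'd"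
  where "conj_transpose g = (\<chi> i j. cnj (g $ j $ i))"

text \<open>The library norm of a matrix is the Hilbert--Schmidt norm, hence the explicit operator norm.\<close>

abbreviation opnorm :: "complex ^ 'd ^ 'd \<Rightarrow> real"
  where "opnorm g \<equiv> onorm (\<lambda>v. g *v v)"

definition GL :: "(complex ^ 'd ^ 'd) measure"
  where "GL = restrict_space borel {g. invertible g}"

definition support :: "(complex ^ 'd ^ 'd) measure \<Rightarrow> (complex ^ 'd ^ 'd) set"
  where "support \<mu> =
    {g \<in> space \<mu>. \<forall>U. open U \<longrightarrow> g \<in> U \<longrightarrow> emeasure \<mu> (U \<inter> space \<mu>) > 0}"

text \<open>Since \<open>\<parallel>g\<parallel> \<parallel>g\<^sup>-\<^sup>1\<parallel> \<ge> 1\<close>, the maximum below is nonnegative, so the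
  conversion to \<^typ>\<open>ennreal\<close> does not truncate anything.\<close>

definition kappa :: "(complex ^ 'd ^ 'd) set \<Rightarrow> ennreal"
  where "kappa S = (SUP g\<in>S. ennreal (max (ln (opnorm g)) (ln (opnorm (matrix_inv g)))))"

definition boundedly_supported :: "(complex ^ 'd ^ 'd) measure \<Rightarrow> bool"
  where "boundedly_supported \<mu> \<longleftrightarrow> kappa (support \<mu>) < \<infinity>"

inductive_set semigroup_gen :: "(complex ^ 'd ^ 'd) set \<Rightarrow> (complex ^ 'd ^ 'd) set"
  for S where
  base: "g \<in> S \<Longrightarrow> g \<in> semigroup_gen S"
| mult: "g \<in> semigroup_gen S \<Longrightarrow> h \<in> semigroup_gen S \<Longrightarrow> g ** h \<in> semigroup_gen S"

text \<open>The empty family is excluded: its union would be trivially preserved.\<close>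

definition strongly_irreducible :: "(complex ^ 'd ^ 'd) set \<Rightarrow> bool"
  where "strongly_irreducible \<Gamma> \<longleftrightarrow>
    \<not> (\<exists>F. finite F \<and> F \<noteq> {} \<and> (\<forall>V\<in>F. vec.subspace V \<and> V \<noteq> {0} \<and> V \<noteq> UNIV) \<and>
        (\<forall>g\<in>\<Gamma>. (\<lambda>v. g *v v) ` (\<Union>F) \<subseteq> \<Union>F))"

definition proximal :: "(complex ^ 'd ^ 'd) set \<Rightarrow> bool"
  where "proximal \<Gamma> \<longleftrightarrow>
    (\<exists>p \<in> closure {\<chi> i j. c * g $ i $ j | c g. g \<in> \<Gamma>}. rank p = 1)"

section \<open>Projective space and stationary measures\<close>

text \<open>Points of the projective space are complex lines; the measurable structure is generated by
  the open sets of the quotient topology inherited from \<open>\<complex>\<^sup>d \<setminus> {0}\<close>.\<close>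

definition proj_points :: "(complex ^ 'd) set set"
  where "proj_points = (\<lambda>x. vec.span {x}) ` (- {0})"

definition proj_borel :: "(complex ^ 'd) set measure"
  where "proj_borel =
    sigma proj_points {U. U \<subseteq> proj_points \<and> open {x. x \<noteq> 0 \<and> vec.span {x} \<in> U}}"

definition stationary :: "(complex ^ 'd ^ 'd) measure \<Rightarrow> (complex ^ 'd) set measure \<Rightarrow> bool"
  where "stationary \<eta> \<nu> \<longleftrightarrow>
    prob_space \<nu> \<and> sets \<nu> = sets proj_borel \<and>
    (\<forall>\<phi> :: (complex ^ 'd) set \<Rightarrow> real.
       \<phi> \<in> borel_measurable proj_borel \<longrightarrow> bounded (\<phi> ` space proj_borel) \<longrightarrow>
       (LINT x|\<nu>. (LINT g|\<eta>. \<phi> ((\<lambda>v. g *v v) ` x))) = (LINT x|\<nu>. \<phi> x))"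

definition adjoint_measure :: "(complex ^ 'd ^ 'd) measure \<Rightarrow> (complex ^ 'd ^ 'd) measure"
  where "adjoint_measure \<mu> = distr \<mu> GL conj_transpose"

text \<open>The function \<open>ln (\<parallel>x\<parallel> \<parallel>y\<parallel> / \<bar>\<langle>x,y\<rangle>\<bar>)\<close> of \<open>x \<noteq> 0\<close> and of the line
  \<open>L = \<complex>y\<close>; it does not depend on the chosen \<open>y\<close>, is nonnegative by Cauchy--Schwarz, and
  takes the value \<open>\<infinity>\<close> when \<open>x\<close> is orthogonal to \<open>L\<close> (where real division by
  zero would give a wrong value).\<close>

definition log_angle :: "complex ^ 'd \<Rightarrow> (complex ^ 'd) set \<Rightarrow> ennreal"
  where "log_angle x L =
    (let y = (SOME y. y \<in> L \<and> y \<noteq> 0) in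
     if herm x y = 0 then \<infinity> else ennreal (ln (norm x * norm y / cmod (herm x y))))"

definition cfrak :: "(complex ^ 'd) set measure \<Rightarrow> ennreal"
  where "cfrak \<nu> = (SUP x \<in> - {0}. \<integral>\<^sup>+ L. log_angle x L \<partial>\<nu>)"

section \<open>Random products\<close>

text \<open>Sequences are indexed from 0, so \<^term>\<open>rprod x n\<close> is \<open>x\<^sub>0 x\<^sub>1 \<cdots> x\<^sub>n\<^sub>-\<^sub>1\<close>.\<close>

primrec rprod :: "(nat \<Rightarrow> complex ^ 'd ^ 'd) \<Rightarrow> nat \<Rightarrow> complex ^ 'd ^ 'd"
  where
  "rprod x 0 = mat 1"
| "rprod x (Suc n) = rprod x n ** x n"

text \<open>The almost sure limit is taken on the canonical space of i.i.d. sequences of law \<open>\<mu>\<close>.\<close>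

definition lyapunov :: "(complex ^ 'd ^ 'd) measure \<Rightarrow> real"
  where "lyapunov \<mu> =
    (THE l. AE x in Pi\<^sub>M (UNIV :: nat set) (\<lambda>_. \<mu>).
       (\<lambda>n. ln (opnorm (rprod x n)) / real n) \<longlonglongrightarrow> l)"

text \<open>\<open>e\<^sup>-\<^sup>a\<close> for \<open>a \<in> [0,\<infinity>]\<close>, with \<open>e\<^sup>-\<^sup>\<infinity> = 0\<close>. In \<^typ>\<open>ennreal\<close> one has \<open>a / 0 = \<infinity>\<close> for
  \<open>a > 0\<close>, so a Gaussian bound of zero width is \<open>0\<close>.\<close>

definition exp_neg :: "ennreal \<Rightarrow> real"
  where "exp_neg a = (if a = \<infinity> then 0 else exp (- enn2real a))"

end

theory Submission
  imports Defs "HOL-Probability.Hoeffding"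
begin

text \<open>Put \<open>\<psi>(x) = \<integral> ln (\<parallel>x\<parallel> \<parallel>y\<parallel> / \<bar>\<langle>x,y\<rangle>\<bar>) d\<nu>(y)\<close>, so \<open>0 \<le> \<psi> \<le> c\<close>. Since
  \<open>\<langle>gx,y\<rangle> = \<langle>x,g\<^sup>*y\<rangle>\<close>, stationarity of \<open>\<nu>\<close> under \<open>\<mu>\<^sup>*\<close> shows that
  \<open>ln (\<parallel>gx\<parallel> / \<parallel>x\<parallel>) - \<psi>(gx) + \<psi>(x)\<close> has the same \<open>\<mu>\<close>-mean \<open>\<lambda>\<close> for every \<open>x\<close>. Hence
  \<open>ln (\<parallel>R\<^sub>n v\<parallel> / \<parallel>v\<parallel>) - n \<lambda>\<close> is, up to an error bounded by \<open>c\<close>, a sum of centred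
  increments lying in intervals of length at most \<open>2 (\<kappa> + c)\<close>, and Hoeffding's lemma together with
  Chernoff's bound gives the first inequality with \<open>\<lambda>\<close> in place of \<open>\<ell>(\<mu>)\<close>. A union bound over
  the standard basis gives the second one, and the latter identifies \<open>\<lambda>\<close> with \<open>\<ell>(\<mu>)\<close> by the
  Borel--Cantelli lemma. If \<open>c = \<infinity>\<close>, both bounds are trivial.\<close>

section \<open>Hermitian geometry and complex lines\<close>

lemma norm_vec_power2: "(norm (x :: complex ^ 'd))\<^sup>2 = (\<Sum>i\<in>UNIV. (cmod (x $ i))\<^sup>2)"
  by (simp add: norm_vec_def L2_set_def sum_nonneg)

lemma herm_self: "herm x x = of_real ((norm x)\<^sup>2)"
  unfolding herm_def norm_vec_power2 of_real_sum
  by (intro sum.cong refl) (simp only: complex_norm_square)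

lemma herm_cauchy_schwarz: "cmod (herm x y) \<le> norm x * norm y"
proof -
  have "cmod (herm x y) \<le> (\<Sum>i\<in>UNIV. \<bar>cmod (x $ i)\<bar> * \<bar>cmod (y $ i)\<bar>)"
    unfolding herm_def by (rule order_trans[OF norm_sum]) (simp add: norm_mult)
  also have "\<dots> \<le> norm x * norm y"
    unfolding norm_vec_def by (rule L2_set_mult_ineq)
  finally show ?thesis .
qed

lemma herm_adjoint: "herm (g *v x) y = herm x (conj_transpose g *v y)"
proof -
  have "herm (g *v x) y = (\<Sum>i\<in>UNIV. \<Sum>j\<in>UNIV. g $ i $ j * x $ j * cnj (y $ i))"
    by (simp add: herm_def matrix_vector_mult_def sum_distrib_right)
  also have "\<dots> = (\<Sum>j\<in>UNIV. \<Sum>i\<in>UNIV. g $ i $ j * x $ j * cnj (y $ i))"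
    by (rule sum.swap)
  also have "\<dots> = herm x (conj_transpose g *v y)"
    by (simp add: herm_def matrix_vector_mult_def conj_transpose_def sum_distrib_left mult_ac)
  finally show ?thesis .
qed

lemma herm_smult_right: "herm x (c *s y) = cnj c * herm x y"
  by (simp add: herm_def sum_distrib_left mult_ac)

lemma norm_smult: "norm (c *s (x :: complex ^ 'd)) = cmod c * norm x"
  by (simp add: norm_vec_def norm_mult L2_set_right_distrib)

lemma conj_transpose_mul: "conj_transpose (g ** h) = conj_transpose h ** conj_transpose g"
  by (simp add: conj_transpose_def matrix_matrix_mult_def vec_eq_iff mult.commute)

lemma conj_transpose_one: "conj_transpose (mat 1) = mat 1"
  by (simp add: conj_transpose_def mat_def vec_eq_iff)

lemma conj_transpose_conj_transpose: "conj_transpose (conj_transpose g) = g"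
  by (simp add: conj_transpose_def vec_eq_iff)

lemma invertible_conj_transpose: "invertible g \<Longrightarrow> invertible (conj_transpose g)"
  by (metis conj_transpose_mul conj_transpose_one invertible_def)

lemma invertible_matrix_vector_eq_0:
  fixes g :: "complex ^ 'd ^ 'd"
  assumes "invertible g"
  shows "g *v v = 0 \<longleftrightarrow> v = 0"
  using assms by (metis invertible_def matrix_vector_mul_assoc matrix_vector_mul_lid matrix_vector_mult_0_right)

lemma bounded_linear_matrix: "bounded_linear (\<lambda>v. (g :: complex ^ 'd ^ 'd) *v v)"
  by (rule matrix_vector_mul_bounded_linear)

lemma norm_matrix_vector_le: "norm ((g :: complex ^ 'd ^ 'd) *v v) \<le> opnorm g * norm v"
  by (rule onorm[OF bounded_linear_matrix])

text \<open>With \<open>w = conj_transpose g *v v\<close>, the square of \<open>norm w\<close> is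
  the modulus of \<open>herm (g *v w) v\<close>. Cauchy-Schwarz and the hypothesis bound it by
  \<open>C * norm w * norm v\<close>, and \<open>norm w\<close> cancels.\<close>

lemma norm_conj_transpose_le:
  assumes "\<And>v. norm (g *v v) \<le> C * norm v"
  shows "norm (conj_transpose g *v v) \<le> C * norm v"
proof (cases "conj_transpose g *v v = 0")
  case True
  have "0 \<le> C * norm v" using assms[of v] norm_ge_zero order_trans by blast
  then show ?thesis using True by simp
next
  case False
  let ?w = "conj_transpose g *v v"
  have "(norm ?w)\<^sup>2 = cmod (herm ?w ?w)"
    by (simp add: herm_self norm_power)
  also have "\<dots> = cmod (herm (g *v ?w) v)"
    by (simp add: herm_adjoint)
  also have "\<dots> \<le> norm (g *v ?w) * norm v"
    by (rule herm_cauchy_schwarz)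
  also have "\<dots> \<le> C * norm ?w * norm v"
    by (intro mult_right_mono assms) auto
  finally have "norm ?w * norm ?w \<le> (C * norm v) * norm ?w"
    by (simp add: power2_eq_square mult_ac)
  then show ?thesis using False by (simp add: mult_right_le_imp_le)
qed

text \<open>The orthogonal projection onto a line, used as a measurable representative of the line.\<close>

definition line_proj :: "(complex ^ 'd) set \<Rightarrow> complex ^ 'd ^ 'd"
  where "line_proj L =
    (let y = (SOME y. y \<in> L \<and> y \<noteq> 0) in \<chi> i j. y $ i * cnj (y $ j) / of_real ((norm y)\<^sup>2))"

lemma span_single: "vec.span {y} = range (\<lambda>c. c *s (y :: complex ^ 'd))"
  by (rule vec.span_singleton)

text \<open>Replacing \<open>y\<close> by a nonzero multiple \<open>c *s y\<close> multiplies
  numerator and denominator by the same factor, the square of \<open>cmod c\<close>, so the choice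
  made in \<open>line_proj\<close> has no effect.\<close>

lemma line_proj_span:
  assumes "y \<noteq> 0"
  shows "line_proj (vec.span {y}) = (\<chi> i j. y $ i * cnj (y $ j) / of_real ((norm y)\<^sup>2))"
proof -
  define z where "z = (SOME z. z \<in> vec.span {y} \<and> z \<noteq> 0)"
  have "z \<in> vec.span {y} \<and> z \<noteq> 0"
    unfolding z_def by (rule someI[of _ y]) (use assms in \<open>auto intro: vec.span_base\<close>)
  then obtain c where z: "z = c *s y" "c \<noteq> 0"
    unfolding span_single by auto
  have "c * cnj c = of_real ((cmod c)\<^sup>2)"
    by (simp only: complex_norm_square)
  then have "z $ i * cnj (z $ j) / of_real ((norm z)\<^sup>2) = y $ i * cnj (y $ j) / of_real ((norm y)\<^sup>2)" for i j
    using z(2) assms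
    by (simp add: z(1) norm_smult power_mult_distrib field_simps)
  then show ?thesis
    unfolding line_proj_def Let_def z_def[symmetric] by simp
qed

lemma line_proj_mult:
  assumes "y \<noteq> 0"
  shows "line_proj (vec.span {y}) *v x = (herm x y / of_real ((norm y)\<^sup>2)) *s y"
  by (simp add: line_proj_span[OF assms] vec_eq_iff matrix_vector_mult_def herm_def
      sum_distrib_left sum_divide_distrib mult_ac)

lemma norm_line_proj_mult:
  assumes "y \<noteq> 0"
  shows "norm (line_proj (vec.span {y}) *v x) = cmod (herm x y) / norm y"
  using assms by (simp add: line_proj_mult norm_smult norm_divide norm_power norm_mult power2_eq_square)

text \<open>Every row of the product is a multiple of the conjugate of \<open>y\<close>, so the
  Hilbert-Schmidt norm can be read off row by row. This expresses the norm cocycle on lines without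
  choosing a vector.\<close>

lemma norm_mult_line_proj:
  assumes "y \<noteq> 0"
  shows "norm (g ** line_proj (vec.span {y})) = norm (g *v y) / norm y"
proof -
  have "(g ** line_proj (vec.span {y})) $ i = ((g *v y) $ i / of_real ((norm y)\<^sup>2)) *s (\<chi> j. cnj (y $ j))" for i
    by (simp add: line_proj_span[OF assms] vec_eq_iff matrix_vector_mult_def matrix_matrix_mult_def
      sum_distrib_left sum_divide_distrib mult_ac)
  then have "norm ((g ** line_proj (vec.span {y})) $ i) = cmod ((g *v y) $ i) * (1 / norm y)" for i
    using assms by (simp add: norm_smult norm_divide norm_power norm_mult power2_eq_square)
       (simp add: norm_vec_def)
  then have "norm (g ** line_proj (vec.span {y})) = L2_set (\<lambda>i. cmod ((g *v y) $ i) * (1 / norm y)) UNIV"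
    by (subst norm_vec_def) simp
  also have "\<dots> = norm (g *v y) / norm y"
    by (subst L2_set_left_distrib[symmetric]) (auto simp: norm_vec_def)
  finally show ?thesis .
qed

lemma image_span: "(\<lambda>v. g *v v) ` vec.span {y} = vec.span {(g :: complex ^ 'd ^ 'd) *v y}"
  unfolding span_single image_image by (simp add: vec.scale)

section \<open>The logarithmic angle and its cocycle identity\<close>

text \<open>The value \<infinity> replaces real division by zero. Where it describes an angle,
  \<open>b \<le> a\<close> holds by Cauchy-Schwarz, so \<open>ennreal\<close> cuts off no negative
  logarithm.\<close>

definition log_ratio :: "real \<Rightarrow> real \<Rightarrow> ennreal"
  where "log_ratio a b = (if b = 0 then \<infinity> else ennreal (ln (a / b)))"

lemma measurable_log_ratio [measurable]:
  assumes [measurable]: "f \<in> borel_measurable M" "h \<in> borel_measurable M"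
  shows "(\<lambda>x. log_ratio (f x) (h x)) \<in> borel_measurable M"
  unfolding log_ratio_def by measurable

text \<open>The right-hand side depends on \<open>L\<close> only through its projection, not through
  a chosen vector; measurability of \<open>log_angle\<close> is derived from this form.\<close>

lemma log_angle_line_proj:
  assumes "L \<in> proj_points"
  shows "log_angle x L = log_ratio (norm x) (norm (line_proj L *v x))"
proof -
  obtain z where z: "L = vec.span {z}" "z \<noteq> 0"
    using assms unfolding proj_points_def by auto
  define y where "y = (SOME y. y \<in> L \<and> y \<noteq> 0)"
  have y: "y \<in> L \<and> y \<noteq> 0"
    unfolding y_def by (rule someI[of _ z]) (use z in \<open>auto intro: vec.span_base\<close>)
  then obtain c where c: "y = c *s z" "c \<noteq> 0" using z unfolding span_single by auto
  have "cmod (herm x y) / norm y = cmod (herm x z) / norm z"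
    using c by (simp add: herm_smult_right norm_smult norm_mult)
  then have "norm (line_proj L *v x) = cmod (herm x y) / norm y"
    using z norm_line_proj_mult by metis
  then show ?thesis
    using y unfolding log_angle_def Let_def y_def[symmetric] log_ratio_def by simp
qed

lemma log_angle_span:
  assumes "y \<noteq> 0"
  shows "log_angle x (vec.span {y}) = log_ratio (norm x) (cmod (herm x y) / norm y)"
  using assms by (subst log_angle_line_proj) (auto simp: proj_points_def norm_line_proj_mult)

text \<open>Moving the adjoint across \<open>herm\<close> turns the denominator into a function of
  \<open>g *v x\<close>. Joint measurability in \<open>g\<close> and \<open>L\<close> then follows
  without treating the action on lines as a measurable map.\<close>

lemma log_angle_image:
  assumes "invertible g" "L \<in> proj_points"
  shows "log_angle x ((\<lambda>v. conj_transpose g *v v) ` L) =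
    log_ratio (norm x * norm (conj_transpose g ** line_proj L)) (norm (line_proj L *v (g *v x)))"
proof -
  obtain y where y: "L = vec.span {y}" "y \<noteq> 0"
    using assms unfolding proj_points_def by auto
  have "conj_transpose g *v y \<noteq> 0"
    using y invertible_matrix_vector_eq_0 invertible_conj_transpose[OF assms(1)] by blast
  then show ?thesis
    using y by (simp add: image_span log_angle_span norm_mult_line_proj norm_line_proj_mult herm_adjoint log_ratio_def)
qed

text \<open>Let \<open>h\<close> be the modulus of \<open>herm (g *v x) y\<close>, which is also
  that of \<open>herm x (conj_transpose g *v y)\<close>. Both sides equal \<open>ln (norm (g *v x) *
  norm (conj_transpose g *v y) / h) + \<kappa>\<close>, or \<infinity> if \<open>h = 0\<close>. The
  shift by \<open>\<kappa>\<close> keeps the logarithms nonnegative, so the identity makes sense in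
  \<open>ennreal\<close>.\<close>

lemma log_angle_cocycle:
  assumes "invertible g" "L \<in> proj_points" "x \<noteq> 0"
    and "0 \<le> ln (norm (conj_transpose g ** line_proj L)) + \<kappa>" "0 \<le> ln (norm (g *v x) / norm x) + \<kappa>"
  shows "log_angle (g *v x) L + ennreal (ln (norm (conj_transpose g ** line_proj L)) + \<kappa>) =
    ennreal (ln (norm (g *v x) / norm x) + \<kappa>) + log_angle x ((\<lambda>v. conj_transpose g *v v) ` L)"
proof -
  obtain y where y: "L = vec.span {y}" "y \<noteq> 0"
    using assms unfolding proj_points_def by auto
  have gy: "conj_transpose g *v y \<noteq> 0"
    using y invertible_matrix_vector_eq_0 invertible_conj_transpose[OF assms(1)] by blast
  have gx: "g *v x \<noteq> 0"
    using assms invertible_matrix_vector_eq_0 by blast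
  define h where "h = cmod (herm (g *v x) y)"
  have h: "h \<le> norm (g *v x) * norm y" "h \<le> norm x * norm (conj_transpose g *v y)" "h \<ge> 0"
    unfolding h_def by (simp_all add: herm_cauchy_schwarz) (simp add: herm_adjoint herm_cauchy_schwarz)
  have 1: "log_angle (g *v x) L = log_ratio (norm (g *v x)) (h / norm y)"
    using y by (simp add: log_angle_span h_def)
  have 2: "log_angle x ((\<lambda>v. conj_transpose g *v v) ` L) = log_ratio (norm x) (h / norm (conj_transpose g *v y))"
    using y gy by (simp add: image_span log_angle_span h_def herm_adjoint)
  have 3: "norm (conj_transpose g ** line_proj L) = norm (conj_transpose g *v y) / norm y"
    using y by (simp add: norm_mult_line_proj)
  show ?thesis
  proof (cases "h = 0")
    case True
    then show ?thesis by (simp add: 1 2 log_ratio_def)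
  next
    case False
    then have h0: "h > 0" using h by simp
    have "0 \<le> ln (norm (g *v x) * norm y / h)" "0 \<le> ln (norm x * norm (conj_transpose g *v y) / h)"
      using h h0 by simp_all
    then show ?thesis
      using h0 y gy gx assms(3-5)
      unfolding 1 2 3 log_ratio_def
      by (simp flip: ennreal_plus) (simp add: ln_div ln_mult)
  qed
qed

section \<open>Measurability\<close>

lemma space_proj_borel: "space proj_borel = proj_points"
  unfolding proj_borel_def by (rule space_measure_of) auto

text \<open>The projection onto the line of \<open>y\<close> is a continuous function of
  \<open>y \<noteq> 0\<close>, so preimages of open sets are open in the quotient topology and hence
  among the generators of \<open>proj_borel\<close>.\<close>

lemma borel_measurable_line_proj: "line_proj \<in> borel_measurable proj_borel"
proof (rule borel_measurableI)
  fix S :: "(complex ^ 'd ^ 'd) set" assume S: "open S"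
  let ?U = "line_proj -` S \<inter> space proj_borel"
  let ?f = "\<lambda>y :: complex ^ 'd. (\<chi> i j. y $ i * cnj (y $ j) / of_real ((norm y)\<^sup>2)) :: complex ^ 'd ^ 'd"
  have "continuous_on (- {0}) ?f"
    by (intro continuous_intros) auto
  then have "open (- {0} \<inter> ?f -` S)"
    using S by (intro continuous_open_preimage) auto
  also have "- {0} \<inter> ?f -` S = {x. x \<noteq> 0 \<and> vec.span {x} \<in> ?U}"
  proof -
    have "vec.span {x} \<in> ?U \<longleftrightarrow> ?f x \<in> S" if "x \<noteq> 0" for x
      using that unfolding line_proj_span[OF that, symmetric]
      by (simp add: space_proj_borel proj_points_def)
    then show ?thesis by blast
  qed
  finally show "?U \<in> sets proj_borel"
    unfolding proj_borel_def
    by (intro in_measure_of) (auto simp: space_proj_borel[unfolded proj_borel_def])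
qed

lemma borel_measurable_matrix_vector_mult [measurable]:
  fixes f :: "'a \<Rightarrow> complex ^ 'n ^ 'm"
  assumes "f \<in> borel_measurable M" "h \<in> borel_measurable M"
  shows "(\<lambda>x. f x *v h x) \<in> borel_measurable M"
proof (rule borel_measurable_continuous_Pair[OF assms])
  show "continuous_on UNIV (\<lambda>x :: (complex ^ 'n ^ 'm) \<times> (complex ^ 'n). fst x *v snd x)"
    unfolding matrix_vector_mult_def by (intro continuous_intros)
qed

lemma borel_measurable_matrix_matrix_mult [measurable]:
  fixes f :: "'a \<Rightarrow> complex ^ 'n ^ 'm" and h :: "'a \<Rightarrow> complex ^ 'k ^ 'n"
  assumes "f \<in> borel_measurable M" "h \<in> borel_measurable M"
  shows "(\<lambda>x. f x ** h x) \<in> borel_measurable M"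
proof (rule borel_measurable_continuous_Pair[OF assms])
  show "continuous_on UNIV (\<lambda>x :: (complex ^ 'n ^ 'm) \<times> (complex ^ 'k ^ 'n). fst x ** snd x)"
    unfolding matrix_matrix_mult_def by (intro continuous_intros)
qed

lemma borel_measurable_conj_transpose [measurable (raw)]:
  assumes "f \<in> borel_measurable M"
  shows "(\<lambda>x. conj_transpose (f x)) \<in> borel_measurable M"
proof (rule borel_measurable_continuous_on[OF _ assms])
  show "continuous_on UNIV (conj_transpose :: complex ^ 'n ^ 'n \<Rightarrow> _)"
    unfolding conj_transpose_def by (intro continuous_intros)
qed

lemma space_GL: "space GL = {g. invertible g}"
  by (simp add: GL_def space_restrict_space)

lemma measurable_ident_GL: "(\<lambda>g. g) \<in> borel_measurable GL"
  unfolding GL_def by (intro measurable_restrict_space1) simp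

lemma measurable_conj_transpose_GL: "conj_transpose \<in> measurable GL GL"
proof -
  have "conj_transpose \<in> borel_measurable GL"
    using borel_measurable_conj_transpose[OF measurable_ident_GL] by simp
  then show ?thesis
    by (subst (2) GL_def, intro measurable_restrict_space2)
       (auto simp: space_GL invertible_conj_transpose)
qed

section \<open>Products of matrices and operator norms\<close>

lemma rprod_cong:
  assumes "\<And>i. i < n \<Longrightarrow> x i = y i"
  shows "rprod x n = rprod y n"
  using assms by (induction n) auto

lemma invertible_rprod:
  assumes "\<And>i. i < n \<Longrightarrow> invertible (x i)"
  shows "invertible (rprod x n)"
  using assms
proof (induction n)
  case 0
  show ?case unfolding invertible_def by (auto intro!: exI[of _ "mat 1"])
qed (simp add: invertible_mult)

lemma abs_ln_ratio_le:
  fixes a b :: real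
  assumes "0 < b" "a \<le> exp \<kappa> * b" "b \<le> exp \<kappa> * a"
  shows "\<bar>ln (a / b)\<bar> \<le> \<kappa>"
proof -
  have a: "0 < a" using assms by (smt (verit) exp_gt_zero zero_less_mult_pos)
  have "ln a \<le> \<kappa> + ln b" "ln b \<le> \<kappa> + ln a"
    using assms a ln_mono[OF assms(2) a] ln_mono[OF assms(3,1)] by (simp_all add: ln_mult)
  then show ?thesis using a assms by (simp add: ln_div abs_le_iff)
qed

text \<open>Cauchy-Schwarz on each row bounds \<open>opnorm\<close> by the Hilbert-Schmidt norm.
  With the triangle inequality this makes \<open>opnorm\<close> 1-Lipschitz, hence
  continuous.\<close>

lemma borel_measurable_opnorm [measurable]:
  assumes "f \<in> borel_measurable M"
  shows "(\<lambda>x. opnorm (f x :: complex ^ 'd ^ 'd)) \<in> borel_measurable M"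
proof (rule borel_measurable_continuous_on[OF _ assms])
  have le: "opnorm g \<le> norm g" for g :: "complex ^ 'd ^ 'd"
  proof (rule onorm_bound)
    fix x :: "complex ^ 'd"
    have "norm (g *v x) \<le> L2_set (\<lambda>i. norm (g $ i) * norm x) UNIV"
      unfolding norm_vec_def[of "g *v x"]
    proof (rule L2_set_mono)
      fix i
      have "cmod ((g *v x) $ i) \<le> (\<Sum>j\<in>UNIV. \<bar>cmod (g $ i $ j)\<bar> * \<bar>cmod (x $ j)\<bar>)"
        unfolding matrix_vector_mult_def vec_lambda_beta
        by (rule order_trans[OF norm_sum]) (simp add: norm_mult)
      also have "\<dots> \<le> norm (g $ i) * norm x"
        unfolding norm_vec_def[of "g $ i"] norm_vec_def[of x] by (rule L2_set_mult_ineq)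
      finally show "cmod ((g *v x) $ i) \<le> norm (g $ i) * norm x" .
    qed simp
    also have "\<dots> = norm g * norm x"
      by (simp add: norm_vec_def[of g] L2_set_left_distrib)
    finally show "norm (g *v x) \<le> norm g * norm x" .
  qed simp
  have lip: "opnorm g - opnorm h \<le> norm (g - h)" for g h :: "complex ^ 'd ^ 'd"
  proof -
    have "opnorm g \<le> opnorm (g - h) + opnorm h"
      using onorm_triangle[OF bounded_linear_matrix[of "g - h"] bounded_linear_matrix[of h]]
      by (simp add: matrix_vector_mult_diff_rdistrib)
    then show ?thesis using le[of "g - h"] by linarith
  qed
  show "continuous_on UNIV (\<lambda>g :: complex ^ 'd ^ 'd. opnorm g)"
  proof (rule lipschitz_on_continuous_on, rule lipschitz_onI)
    fix g h :: "complex ^ 'd ^ 'd"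
    show "dist (opnorm g) (opnorm h) \<le> 1 * dist g h"
      using lip[of g h] lip[of h g] by (simp add: dist_norm norm_minus_commute)
  qed simp
qed

text \<open>Expand \<open>x\<close> in the standard basis and apply Cauchy-Schwarz to its
  coordinates and the constant \<open>C\<close>. The factor is the square root of the dimension,
  which contributes only \<open>ln (real CARD('d)) / 2\<close> to a logarithm.\<close>

lemma opnorm_le_basis:
  fixes g :: "complex ^ 'd ^ 'd"
  assumes "\<And>i. norm (g *v axis i 1) \<le> C"
  shows "opnorm g \<le> sqrt (real CARD('d)) * C"
proof (rule onorm_bound)
  have C: "0 \<le> C" using assms norm_ge_zero order_trans by blast
  then show "0 \<le> sqrt (real CARD('d)) * C" by simp
  fix x :: "complex ^ 'd"
  have "g *v x = (\<Sum>i\<in>UNIV. x $ i *s (g *v axis i 1))"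
    by (simp add: vec_eq_iff matrix_vector_mult_def axis_def if_distrib sum.delta mult.commute cong: if_cong)
  then have "norm (g *v x) \<le> (\<Sum>i\<in>UNIV. cmod (x $ i) * norm (g *v axis i 1))"
    by (simp add: sum_norm_le norm_smult)
  also have "\<dots> \<le> (\<Sum>i\<in>UNIV. \<bar>cmod (x $ i)\<bar> * \<bar>C\<bar>)"
    using assms C by (intro sum_mono) (auto intro: mult_left_mono)
  also have "\<dots> \<le> norm x * L2_set (\<lambda>i :: 'd. C) UNIV"
    unfolding norm_vec_def[of x] by (rule L2_set_mult_ineq)
  also have "L2_set (\<lambda>i :: 'd. C) UNIV = sqrt (real CARD('d)) * C"
    using C by (simp add: L2_set_def real_sqrt_mult)
  finally show "norm (g *v x) \<le> sqrt (real CARD('d)) * C * norm x"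
    by (simp add: mult_ac)
qed

section \<open>The cohomological equation and concentration\<close>

text \<open>The setting with finite constants: \<open>\<kappa>\<close> controls how far almost every
  \<open>g\<close> and its inverse stretch vectors, and \<open>c\<close> is a real upper bound for
  \<open>cfrak \<nu>\<close>.\<close>

locale matrix_walk = prob_space \<mu>
  for \<mu> :: "(complex ^ 'd ^ 'd) measure" +
  fixes \<nu> :: "(complex ^ 'd) set measure" and \<kappa> c :: real
  assumes sets_mu: "sets \<mu> = sets GL"
    and stationary_nu: "stationary (adjoint_measure \<mu>) \<nu>"
    and kappa_nonneg: "0 \<le> \<kappa>"
    and norm_bounds: "AE g in \<mu>. \<forall>v. norm (g *v v) \<le> exp \<kappa> * norm v \<and> norm v \<le> exp \<kappa> * norm (g *v v)"
    and c_nonneg: "0 \<le> c"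
    and cfrak_le: "cfrak \<nu> \<le> ennreal c"
begin

section \<open>Measurability and stationarity for nonnegative functions\<close>

lemma space_mu: "space \<mu> = {g. invertible g}"
  using sets_eq_imp_space_eq[OF sets_mu] by (simp add: space_GL)

lemma measurable_ident_mu [measurable]: "(\<lambda>g. g) \<in> borel_measurable \<mu>"
  using measurable_ident_GL by (simp add: measurable_cong_sets[OF sets_mu refl])

lemma prob_space_nu: "prob_space \<nu>" and sets_nu: "sets \<nu> = sets proj_borel"
  using stationary_nu by (auto simp: stationary_def)

sublocale nu: prob_space \<nu> by (rule prob_space_nu)

sublocale mu_nu: pair_prob_space \<mu> \<nu> ..

lemma space_nu: "space \<nu> = proj_points"
  using sets_eq_imp_space_eq[OF sets_nu] by (simp add: space_proj_borel)

lemma measurable_line_proj_nu [measurable]: "line_proj \<in> borel_measurable \<nu>"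
  using borel_measurable_line_proj by (simp add: measurable_cong_sets[OF sets_nu refl])

lemma measurable_log_angle:
  assumes [measurable]: "f \<in> borel_measurable M" "h \<in> measurable M \<nu>"
  shows "(\<lambda>x. log_angle (f x) (h x)) \<in> borel_measurable M"
proof -
  have "(\<lambda>x. log_ratio (norm (f x)) (norm (line_proj (h x) *v f x))) \<in> borel_measurable M"
    by measurable
  then show ?thesis
    using measurable_space[OF assms(2)]
    by (subst measurable_cong) (auto simp: space_nu log_angle_line_proj)
qed

lemma measurable_log_angle_image:
  "(\<lambda>(g, L). log_angle x ((\<lambda>v. conj_transpose g *v v) ` L)) \<in> borel_measurable (\<mu> \<Otimes>\<^sub>M \<nu>)"
proof -
  have "(\<lambda>(g, L). log_ratio (norm x * norm (conj_transpose g ** line_proj L)) (norm (line_proj L *v (g *v x))))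
      \<in> borel_measurable (\<mu> \<Otimes>\<^sub>M \<nu>)"
    by measurable
  then show ?thesis
    by (rule measurable_cong[THEN iffD2, rotated])
       (auto simp: space_pair_measure space_mu space_nu log_angle_image)
qed

text \<open>Stationarity is given for bounded real functions. It is applied to the truncations of
  \<open>F\<close> at \<open>N\<close>, and monotone convergence in \<open>N\<close> carries it to
  \<open>F\<close>, which may take the value \<infinity>.\<close>

lemma nn_integral_stationary:
  fixes F :: "(complex ^ 'd) set \<Rightarrow> ennreal"
  assumes F [measurable]: "F \<in> borel_measurable \<nu>"
    and F' [measurable]: "(\<lambda>(g, L). F ((\<lambda>v. conj_transpose g *v v) ` L)) \<in> borel_measurable (\<mu> \<Otimes>\<^sub>M \<nu>)"
  shows "(\<integral>\<^sup>+ L. (\<integral>\<^sup>+ g. F ((\<lambda>v. conj_transpose g *v v) ` L) \<partial>\<mu>) \<partial>\<nu>) = (\<integral>\<^sup>+ L. F L \<partial>\<nu>)"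
proof -
  let ?act = "\<lambda>g :: complex ^ 'd ^ 'd. \<lambda>L. (\<lambda>v. conj_transpose g *v v) ` L"
  define \<phi> where "\<phi> N L = enn2real (min (F L) (of_nat N))" for N :: nat and L
  have fin: "min a (of_nat N :: ennreal) < top" for a N
    by (simp add: min_less_iff_disj of_nat_less_top)
  have \<phi>: "ennreal (\<phi> N L) = min (F L) (of_nat N)" for N L
    unfolding \<phi>_def by (rule ennreal_enn2real[OF fin])
  have \<phi>_le: "\<bar>\<phi> N L\<bar> \<le> real N" for N L
  proof -
    have "enn2real (min (F L) (of_nat N)) \<le> enn2real (of_nat N)"
      by (intro enn2real_mono) (auto simp: of_nat_less_top)
    then show ?thesis by (simp add: \<phi>_def)
  qed
  have \<phi>_meas [measurable]: "\<phi> N \<in> borel_measurable \<nu>" for N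
    unfolding \<phi>_def by measurable
  have \<phi>'_meas [measurable]: "(\<lambda>(g, L). \<phi> N (?act g L)) \<in> borel_measurable (\<mu> \<Otimes>\<^sub>M \<nu>)" for N
    using F' unfolding \<phi>_def split_beta' by measurable
  have sec: "(\<lambda>g. \<phi> N (?act g L)) \<in> borel_measurable \<mu>" if "L \<in> space \<nu>" for N L
    using that by measurable
  have bounded_step: "(\<integral>\<^sup>+ L. (\<integral>\<^sup>+ g. \<phi> N (?act g L) \<partial>\<mu>) \<partial>\<nu>) = (\<integral>\<^sup>+ L. \<phi> N L \<partial>\<nu>)" for N
  proof -
    have inner: "(LINT g|adjoint_measure \<mu>. \<phi> N ((\<lambda>v. g *v v) ` L)) = (LINT g|\<mu>. \<phi> N (?act g L))"
      if L: "L \<in> space \<nu>" for L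
      unfolding adjoint_measure_def
    proof (rule integral_distr)
      show "conj_transpose \<in> measurable \<mu> GL"
        using measurable_conj_transpose_GL by (simp add: measurable_cong_sets[OF sets_mu refl])
      have "(\<lambda>g. \<phi> N (?act g L)) \<in> borel_measurable GL"
        using sec[OF L] by (simp add: measurable_cong_sets[OF sets_mu refl])
      \<comment> \<open>Since \<open>conj_transpose\<close> is an involution, composing with it
        turns measurability along the adjoint action into measurability along the action
        itself.\<close>
      from measurable_compose[OF measurable_conj_transpose_GL this]
      show "(\<lambda>g. \<phi> N ((\<lambda>v. g *v v) ` L)) \<in> borel_measurable GL"
        by (simp add: conj_transpose_conj_transpose)
    qed
    have int: "integrable \<mu> (\<lambda>g. \<phi> N (?act g L))" if "L \<in> space \<nu>" for L
      by (rule integrable_const_bound[of _ "real N"]) (use sec[OF that] \<phi>_le in auto)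
    have nn: "0 \<le> \<phi> N L" for L by (simp add: \<phi>_def)
    have meas2: "(\<lambda>L. LINT g|\<mu>. \<phi> N (?act g L)) \<in> borel_measurable \<nu>"
      by measurable
    have le2: "norm (LINT g|\<mu>. \<phi> N (?act g L)) \<le> real N" if "L \<in> space \<nu>" for L
      using integral_le_const[OF int[OF that], of "real N"] \<phi>_le nn
      by (auto simp: abs_le_iff integral_nonneg)
    have "(\<integral>\<^sup>+ L. (\<integral>\<^sup>+ g. \<phi> N (?act g L) \<partial>\<mu>) \<partial>\<nu>) = (\<integral>\<^sup>+ L. ennreal (LINT g|\<mu>. \<phi> N (?act g L)) \<partial>\<nu>)"
      by (intro nn_integral_cong nn_integral_eq_integral int) (auto simp: nn)
    also have "\<dots> = ennreal (LINT L|\<nu>. LINT g|\<mu>. \<phi> N (?act g L))"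
      by (intro nn_integral_eq_integral nu.integrable_const_bound[of _ "real N"] AE_I2 meas2 le2)
         (auto simp: nn integral_nonneg)
    also have "(LINT L|\<nu>. LINT g|\<mu>. \<phi> N (?act g L)) =
        (LINT L|\<nu>. LINT g|adjoint_measure \<mu>. \<phi> N ((\<lambda>v. g *v v) ` L))"
      by (intro Bochner_Integration.integral_cong refl inner[symmetric])
    also have "\<dots> = (LINT L|\<nu>. \<phi> N L)"
    proof -
      have "bounded (\<phi> N ` space proj_borel)"
        using \<phi>_le by (auto simp: bounded_iff)
      moreover have "\<phi> N \<in> borel_measurable proj_borel"
        using \<phi>_meas by (simp add: measurable_cong_sets[OF sets_nu refl])
      ultimately show ?thesis
        using stationary_nu unfolding stationary_def by blast
    qed
    also have "ennreal \<dots> = (\<integral>\<^sup>+ L. \<phi> N L \<partial>\<nu>)"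
      by (intro nn_integral_eq_integral[symmetric] nu.integrable_const_bound[of _ "real N"] AE_I2)
         (use abs_le_D1[OF \<phi>_le] nn in auto)
    finally show ?thesis .
  qed
  have sup: "a = (SUP N. min a (of_nat N :: ennreal))" for a :: ennreal
  proof -
    have "(SUP N. min a (of_nat N)) = min a (SUP N. of_nat N :: ennreal)"
      by (simp flip: inf_min add: inf_SUP)
    then show ?thesis by (simp add: ennreal_SUP_of_nat_eq_top)
  qed
  have inc: "incseq (\<lambda>N. min a (of_nat N :: ennreal))" for a
    by (auto simp: incseq_def min.coboundedI2)
  have incfun: "incseq (\<lambda>N x. min (h x) (of_nat N :: ennreal))" for h :: "'z \<Rightarrow> ennreal"
    using inc by (auto simp: incseq_def le_fun_def)
  have secF: "(\<lambda>g. F (?act g L)) \<in> borel_measurable \<mu>" if "L \<in> space \<nu>" for L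
    using that by measurable
  have "(\<integral>\<^sup>+ L. (\<integral>\<^sup>+ g. F (?act g L) \<partial>\<mu>) \<partial>\<nu>) =
      (\<integral>\<^sup>+ L. (\<integral>\<^sup>+ g. (SUP N. min (F (?act g L)) (of_nat N)) \<partial>\<mu>) \<partial>\<nu>)"
    by (simp flip: sup)
  also have "\<dots> = (\<integral>\<^sup>+ L. (SUP N. \<integral>\<^sup>+ g. min (F (?act g L)) (of_nat N) \<partial>\<mu>) \<partial>\<nu>)"
    by (intro nn_integral_cong nn_integral_monotone_convergence_SUP incfun borel_measurable_min secF) auto
  also have "\<dots> = (SUP N. \<integral>\<^sup>+ L. (\<integral>\<^sup>+ g. min (F (?act g L)) (of_nat N) \<partial>\<mu>) \<partial>\<nu>)"
  proof (rule nn_integral_monotone_convergence_SUP)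
    show "incseq (\<lambda>N L. \<integral>\<^sup>+ g. min (F (?act g L)) (of_nat N) \<partial>\<mu>)"
      by (auto simp: incseq_def le_fun_def min.coboundedI2 intro!: nn_integral_mono)
  qed measurable
  also have "\<dots> = (SUP N. \<integral>\<^sup>+ L. min (F L) (of_nat N) \<partial>\<nu>)"
    using bounded_step by (simp add: \<phi>)
  also have "\<dots> = (\<integral>\<^sup>+ L. (SUP N. min (F L) (of_nat N)) \<partial>\<nu>)"
    by (intro nn_integral_monotone_convergence_SUP[symmetric] incfun) measurable
  also have "\<dots> = (\<integral>\<^sup>+ L. F L \<partial>\<nu>)"
    by (simp flip: sup)
  finally show ?thesis .
qed

section \<open>The potential and the cohomological equation\<close>

text \<open>This is the function \<psi> of the introduction. At \<open>x = 0\<close> the integral is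
  \<infinity> and \<open>enn2real\<close> gives 0, so nonnegativity holds for all \<open>x\<close>,
  while finiteness of the integral is asserted only off 0.\<close>

definition potential :: "complex ^ 'd \<Rightarrow> real"
  where "potential x = enn2real (\<integral>\<^sup>+ L. log_angle x L \<partial>\<nu>)"

text \<open>This is the Furstenberg integral of the norm cocycle of the adjoint matrices on lines.
  Adding \<open>\<kappa>\<close> inside and subtracting it outside allows a nonnegative
  integral.\<close>

definition drift :: real
  where "drift = enn2real (\<integral>\<^sup>+ L. (\<integral>\<^sup>+ g. ennreal (ln (norm (conj_transpose g ** line_proj L)) + \<kappa>) \<partial>\<mu>) \<partial>\<nu>) - \<kappa>"

definition increment :: "complex ^ 'd \<Rightarrow> complex ^ 'd ^ 'd \<Rightarrow> real"
  where "increment x g = ln (norm (g *v x) / norm x) - potential (g *v x) + potential x - drift"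

lemma nn_integral_log_angle:
  assumes "x \<noteq> 0"
  shows "(\<integral>\<^sup>+ L. log_angle x L \<partial>\<nu>) = ennreal (potential x)"
    and "potential x \<le> c"
proof -
  have le: "(\<integral>\<^sup>+ L. log_angle x L \<partial>\<nu>) \<le> ennreal c"
    by (rule order_trans[OF _ cfrak_le]) (use assms in \<open>auto simp: cfrak_def intro: SUP_upper\<close>)
  then show "(\<integral>\<^sup>+ L. log_angle x L \<partial>\<nu>) = ennreal (potential x)"
    unfolding potential_def by (subst ennreal_enn2real) (auto simp: le_less_trans)
  show "potential x \<le> c"
    unfolding potential_def using le c_nonneg enn2real_leI by blast
qed

lemma potential_nonneg: "0 \<le> potential x"
  by (simp add: potential_def)

lemma measurable_potential [measurable]: "potential \<in> borel_measurable borel"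
proof -
  have "(\<lambda>p. log_angle (fst p) (snd p)) \<in> borel_measurable (borel \<Otimes>\<^sub>M \<nu>)"
    by (rule measurable_log_angle) measurable
  then have "(\<lambda>x. \<integral>\<^sup>+ L. log_angle x L \<partial>\<nu>) \<in> borel_measurable borel"
    by (intro nu.borel_measurable_nn_integral) (simp add: split_beta')
  then show ?thesis unfolding potential_def[abs_def] by measurable
qed

lemma measurable_increment [measurable]: "increment x \<in> borel_measurable \<mu>"
  unfolding increment_def[abs_def] by measurable

text \<open>The inverse \<open>h\<close> of \<open>g\<close> stretches vectors by at most
  \<open>exp \<kappa>\<close>, and so do the adjoints of \<open>g\<close> and \<open>h\<close> by
  \<open>norm_conj_transpose_le\<close>. The exceptional null set depends on neither
  \<open>x\<close> nor \<open>L\<close>.\<close>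

lemma AE_ln_bounds:
  "AE g in \<mu>. invertible g \<and> (\<forall>x. x \<noteq> 0 \<longrightarrow> g *v x \<noteq> 0 \<and> \<bar>ln (norm (g *v x) / norm x)\<bar> \<le> \<kappa>)
    \<and> (\<forall>L\<in>proj_points. \<bar>ln (norm (conj_transpose g ** line_proj L))\<bar> \<le> \<kappa>)"
  using norm_bounds AE_space
proof eventually_elim
  case (elim g)
  then have g: "invertible g" by (simp add: space_mu)
  then obtain h where h: "g ** h = mat 1" unfolding invertible_def by blast
  have "norm (h *v w) \<le> exp \<kappa> * norm w" for w
    using elim(1)[rule_format, of "h *v w"] h
    by (simp add: matrix_vector_mul_assoc)
  then have h_adj: "norm (conj_transpose h *v w) \<le> exp \<kappa> * norm w" for w
    by (rule norm_conj_transpose_le)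
  have g_adj: "norm (conj_transpose g *v w) \<le> exp \<kappa> * norm w" for w
    by (rule norm_conj_transpose_le) (use elim in auto)
  have inv: "conj_transpose h *v (conj_transpose g *v w) = w" for w
    by (simp add: matrix_vector_mul_assoc h conj_transpose_one flip: conj_transpose_mul)
  have "\<bar>ln (norm (conj_transpose g ** line_proj L))\<bar> \<le> \<kappa>" if L: "L \<in> proj_points" for L
  proof -
    obtain y where y: "L = vec.span {y}" "y \<noteq> 0"
      using L unfolding proj_points_def by auto
    show ?thesis
      using abs_ln_ratio_le[of "norm y" "norm (conj_transpose g *v y)" \<kappa>]
        g_adj[of y] h_adj[of "conj_transpose g *v y"] y
      by (simp add: norm_mult_line_proj inv)
  qed
  moreover have "\<bar>ln (norm (g *v x) / norm x)\<bar> \<le> \<kappa>" if "x \<noteq> 0" for x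
    using that elim by (intro abs_ln_ratio_le) auto
  ultimately show ?case
    using g invertible_matrix_vector_eq_0 by blast
qed

text \<open>The integrand is almost everywhere at most \<open>2 * \<kappa>\<close>, so the integral
  is finite and \<open>enn2real\<close> in \<open>drift\<close> loses nothing.\<close>

lemma ennreal_drift: "ennreal (drift + \<kappa>) =
  (\<integral>\<^sup>+ L. (\<integral>\<^sup>+ g. ennreal (ln (norm (conj_transpose g ** line_proj L)) + \<kappa>) \<partial>\<mu>) \<partial>\<nu>)" (is "_ = ?I")
proof -
  have "?I \<le> (\<integral>\<^sup>+ L. (\<integral>\<^sup>+ g. ennreal (2 * \<kappa>) \<partial>\<mu>) \<partial>\<nu>)"
  proof (rule nn_integral_mono, rule nn_integral_mono_AE)
    fix L assume "L \<in> space \<nu>"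
    then have L: "L \<in> proj_points" by (simp add: space_nu)
    show "AE g in \<mu>. ennreal (ln (norm (conj_transpose g ** line_proj L)) + \<kappa>) \<le> ennreal (2 * \<kappa>)"
      using AE_ln_bounds
    proof eventually_elim
      case (elim g)
      then have "\<bar>ln (norm (conj_transpose g ** line_proj L))\<bar> \<le> \<kappa>" using L by blast
      then show ?case by (intro ennreal_leI) linarith
    qed
  qed
  also have "\<dots> = ennreal (2 * \<kappa>)"
    by (simp add: emeasure_space_1 nu.emeasure_space_1)
  finally show ?thesis
    unfolding drift_def by (simp add: le_less_trans)
qed

text \<open>The function \<open>potential\<close> solves the cohomological equation of the norm cocycle: by
  duality \<open>\<langle>gx, y\<rangle> = \<langle>x, g\<^sup>*y\<rangle>\<close>, and the term in \<open>g\<^sup>*y\<close> is integrated out by stationarity.\<close>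

lemma nn_integral_cohomological:
  assumes x: "x \<noteq> 0"
  shows "(\<integral>\<^sup>+ g. ennreal (potential (g *v x)) \<partial>\<mu>) + ennreal (drift + \<kappa>) =
    (\<integral>\<^sup>+ g. ennreal (ln (norm (g *v x) / norm x) + \<kappa>) \<partial>\<mu>) + ennreal (potential x)"
proof -
  let ?A = "\<lambda>g L. ennreal (ln (norm (conj_transpose g ** line_proj L)) + \<kappa>)"
  let ?B = "\<lambda>g L. log_angle x ((\<lambda>v. conj_transpose g *v v) ` L)"
  have A [measurable]: "(\<lambda>(g, L). ?A g L) \<in> borel_measurable (\<mu> \<Otimes>\<^sub>M \<nu>)"
    by measurable
  have B: "(\<lambda>(g, L). ?B g L) \<in> borel_measurable (\<mu> \<Otimes>\<^sub>M \<nu>)"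
    by (rule measurable_log_angle_image)
  have Lx: "(\<lambda>L. log_angle y L) \<in> borel_measurable \<nu>" for y
    by (rule measurable_log_angle) measurable
  have AL: "(\<lambda>L. ?A g L) \<in> borel_measurable \<nu>" for g
    by measurable
  have BL: "(\<lambda>L. ?B g L) \<in> borel_measurable \<nu>" if "g \<in> space \<mu>" for g
    using measurable_compose[OF measurable_Pair1'[OF that] B] by simp
  have C: "(\<lambda>g. \<integral>\<^sup>+ L. log_angle (g *v x) L \<partial>\<nu>) \<in> borel_measurable \<mu>"
  proof (rule nu.borel_measurable_nn_integral)
    show "(\<lambda>(g, L). log_angle (g *v x) L) \<in> borel_measurable (\<mu> \<Otimes>\<^sub>M \<nu>)"
      unfolding split_beta' by (rule measurable_log_angle) measurable
  qed
  have "(\<integral>\<^sup>+ g. ennreal (potential (g *v x)) \<partial>\<mu>) = (\<integral>\<^sup>+ g. (\<integral>\<^sup>+ L. log_angle (g *v x) L \<partial>\<nu>) \<partial>\<mu>)"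
    by (rule nn_integral_cong_AE, rule AE_mp[OF AE_ln_bounds]) (auto simp: x nn_integral_log_angle)
  moreover have "ennreal (drift + \<kappa>) = (\<integral>\<^sup>+ g. (\<integral>\<^sup>+ L. ?A g L \<partial>\<nu>) \<partial>\<mu>)"
    unfolding ennreal_drift by (rule mu_nu.Fubini'[OF A])
  ultimately have "(\<integral>\<^sup>+ g. ennreal (potential (g *v x)) \<partial>\<mu>) + ennreal (drift + \<kappa>) =
      (\<integral>\<^sup>+ g. (\<integral>\<^sup>+ L. log_angle (g *v x) L \<partial>\<nu>) + (\<integral>\<^sup>+ L. ?A g L \<partial>\<nu>) \<partial>\<mu>)"
    using C by (simp add: nn_integral_add)
  also have "\<dots> = (\<integral>\<^sup>+ g. (\<integral>\<^sup>+ L. log_angle (g *v x) L + ?A g L \<partial>\<nu>) \<partial>\<mu>)"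
    by (simp add: nn_integral_add Lx AL)
  also have "\<dots> = (\<integral>\<^sup>+ g. (\<integral>\<^sup>+ L. ennreal (ln (norm (g *v x) / norm x) + \<kappa>) + ?B g L \<partial>\<nu>) \<partial>\<mu>)"
  proof (rule nn_integral_cong_AE, rule AE_mp[OF AE_ln_bounds], intro AE_I2 impI nn_integral_cong, elim conjE)
    fix g :: "complex ^ 'd ^ 'd" and L
    assume "invertible g" and 1: "\<forall>x. x \<noteq> 0 \<longrightarrow> g *v x \<noteq> 0 \<and> \<bar>ln (norm (g *v x) / norm x)\<bar> \<le> \<kappa>"
      and 2: "\<forall>L\<in>proj_points. \<bar>ln (norm (conj_transpose g ** line_proj L))\<bar> \<le> \<kappa>" and L: "L \<in> space \<nu>"
    from \<open>invertible g\<close> show "log_angle (g *v x) L + ?A g L =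
        ennreal (ln (norm (g *v x) / norm x) + \<kappa>) + ?B g L"
    proof (rule log_angle_cocycle)
      show "L \<in> proj_points" using L by (simp add: space_nu)
      then show "0 \<le> ln (norm (conj_transpose g ** line_proj L)) + \<kappa>"
        using 2 by (auto simp: abs_le_iff)
      show "0 \<le> ln (norm (g *v x) / norm x) + \<kappa>"
        using 1[rule_format, OF x] by linarith
    qed (rule x)
  qed
  also have "\<dots> = (\<integral>\<^sup>+ g. ennreal (ln (norm (g *v x) / norm x) + \<kappa>) + (\<integral>\<^sup>+ L. ?B g L \<partial>\<nu>) \<partial>\<mu>)"
    by (intro nn_integral_cong) (simp add: nn_integral_add BL nu.emeasure_space_1)
  also have "\<dots> = (\<integral>\<^sup>+ g. ennreal (ln (norm (g *v x) / norm x) + \<kappa>) \<partial>\<mu>) + (\<integral>\<^sup>+ g. (\<integral>\<^sup>+ L. ?B g L \<partial>\<nu>) \<partial>\<mu>)"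
    by (rule nn_integral_add[OF _ nu.borel_measurable_nn_integral[OF B]]) measurable
  \<comment> \<open>Exchanging the integrals puts \<open>g\<close> inside, the order in which
    stationarity removes the adjoint action.\<close>
  also have "(\<integral>\<^sup>+ g. (\<integral>\<^sup>+ L. ?B g L \<partial>\<nu>) \<partial>\<mu>) = (\<integral>\<^sup>+ L. (\<integral>\<^sup>+ g. ?B g L \<partial>\<mu>) \<partial>\<nu>)"
    by (rule mu_nu.Fubini'[OF B, symmetric])
  also have "\<dots> = (\<integral>\<^sup>+ L. log_angle x L \<partial>\<nu>)"
    by (rule nn_integral_stationary[OF Lx B])
  also have "\<dots> = ennreal (potential x)"
    by (rule nn_integral_log_angle[OF x])
  finally show ?thesis .
qed

section \<open>Centred bounded increments\<close>

text \<open>Both \<open>g\<close>-dependent terms are bounded almost everywhere, so the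
  cohomological equation in \<open>ennreal\<close> can be read as one between real expectations,
  where \<open>\<kappa>\<close> cancels.\<close>

lemma expectation_increment:
  assumes x: "x \<noteq> 0"
  shows "expectation (increment x) = 0"
proof -
  let ?s = "\<lambda>g. ln (norm (g *v x) / norm x)"
  let ?p = "\<lambda>g. potential (g *v x)"
  have s: "integrable \<mu> ?s"
    by (rule integrable_const_bound[of _ \<kappa>], rule AE_mp[OF AE_ln_bounds]) (use x in auto)
  have p: "integrable \<mu> ?p"
    by (rule integrable_const_bound[of _ c], rule AE_mp[OF AE_ln_bounds])
       (use x in \<open>auto simp: potential_nonneg nn_integral_log_angle(2)\<close>)
  have pos: "AE g in \<mu>. 0 \<le> ?s g + \<kappa>"
    using AE_ln_bounds
  proof eventually_elim
    case (elim g)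
    then have "\<bar>?s g\<bar> \<le> \<kappa>" using x by blast
    then show ?case by linarith
  qed
  have "(\<integral>\<^sup>+ g. ennreal (?p g) \<partial>\<mu>) = ennreal (expectation ?p)"
    by (intro nn_integral_eq_integral p) (simp add: potential_nonneg)
  moreover have "(\<integral>\<^sup>+ g. ennreal (?s g + \<kappa>) \<partial>\<mu>) = ennreal (expectation (\<lambda>g. ?s g + \<kappa>))"
    by (intro nn_integral_eq_integral pos) (use s in auto)
  moreover have "expectation (\<lambda>g. ?s g + \<kappa>) = expectation ?s + \<kappa>"
    using s by (simp add: prob_space)
  ultimately have "ennreal (expectation ?p) + ennreal (drift + \<kappa>) = ennreal (expectation ?s + \<kappa>) + ennreal (potential x)"
    using nn_integral_cohomological[OF x] by simp
  moreover have "0 \<le> expectation ?p"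
    by (simp add: potential_nonneg integral_nonneg)
  moreover have "0 \<le> expectation (\<lambda>g. ?s g + \<kappa>)"
    by (rule integral_nonneg_AE[OF pos])
  moreover have "0 \<le> drift + \<kappa>"
    by (simp add: drift_def)
  ultimately have "expectation ?p + (drift + \<kappa>) = expectation ?s + \<kappa> + potential x"
    using \<open>expectation (\<lambda>g. ?s g + \<kappa>) = _\<close> potential_nonneg[of x]
    by (simp flip: ennreal_plus)
  then show ?thesis
    unfolding increment_def[abs_def] using s p by (simp add: prob_space)
qed

text \<open>The logarithm lies within \<open>\<kappa>\<close> of 0 and the potential at
  \<open>g *v x\<close> lies between 0 and \<open>c\<close>. The interval moves with
  \<open>x\<close>, but its length \<open>2 * \<kappa> + c\<close> does not.\<close>

lemma AE_increment:
  assumes x: "x \<noteq> 0"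
  shows "AE g in \<mu>. increment x g \<in> {- \<kappa> - c + (potential x - drift)..\<kappa> + (potential x - drift)}"
  using AE_ln_bounds
proof eventually_elim
  case (elim g)
  then have "g *v x \<noteq> 0" "\<bar>ln (norm (g *v x) / norm x)\<bar> \<le> \<kappa>" using x by auto
  then show ?case
    using potential_nonneg[of "g *v x"] nn_integral_log_angle(2)[of "g *v x"]
    unfolding increment_def atLeastAtMost_iff by linarith
qed

text \<open>Hoeffding's lemma gives \<open>(b - a)\<^sup>2 / 8\<close> in the exponent, and
  \<open>b - a\<close> is at most \<open>2 * (\<kappa> + c)\<close>. Negative \<open>l\<close> is
  reduced to positive \<open>l\<close> by changing the sign of the increment.\<close>

lemma nn_integral_exp_increment:
  assumes x: "x \<noteq> 0"
  shows "(\<integral>\<^sup>+ g. ennreal (exp (l * increment x g)) \<partial>\<mu>) \<le> ennreal (exp (l\<^sup>2 * (\<kappa> + c)\<^sup>2 / 2))"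
proof -
  define a b where "a = - \<kappa> - c + (potential x - drift)" and "b = \<kappa> + (potential x - drift)"
  have width: "l\<^sup>2 * (b - a)\<^sup>2 / 8 \<le> l\<^sup>2 * (\<kappa> + c)\<^sup>2 / 2"
  proof -
    have "(b - a)\<^sup>2 \<le> (2 * (\<kappa> + c))\<^sup>2"
      using kappa_nonneg c_nonneg by (intro power_mono) (auto simp: a_def b_def)
    from mult_left_mono[OF this, of "l\<^sup>2"] show ?thesis
      unfolding power_mult_distrib by simp
  qed
  consider "l = 0" | "l > 0" | "l < 0" by linarith
  then have "(\<integral>\<^sup>+ g. ennreal (exp (l * increment x g)) \<partial>\<mu>) \<le> ennreal (exp (l\<^sup>2 * (b - a)\<^sup>2 / 8))"
  proof cases
    case 1
    then show ?thesis by (simp add: emeasure_space_1)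
  next
    case 2
    interpret interval_bounded_random_variable \<mu> "increment x" a b
      by standard (use AE_increment[OF x] in \<open>auto simp: a_def b_def\<close>)
    show ?thesis
      using Hoeffdings_lemma_nn_integral_0[OF 2 expectation_increment[OF x]] by simp
  next
    case 3
    interpret interval_bounded_random_variable \<mu> "\<lambda>g. - increment x g" "- b" "- a"
      by standard (use AE_increment[OF x] in \<open>auto simp: a_def b_def\<close>)
    show ?thesis
      using Hoeffdings_lemma_nn_integral_0[of "- l"] 3 expectation_increment[OF x]
      by (simp add: power2_commute)
  qed
  also have "\<dots> \<le> ennreal (exp (l\<^sup>2 * (\<kappa> + c)\<^sup>2 / 2))"
    using width by (intro ennreal_leI) simp
  finally show ?thesis .
qed

section \<open>Exponential moments and tail bounds for the random product\<close>

interpretation P: product_prob_space "\<lambda>_. \<mu>" "UNIV :: nat set" ..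

text \<open>The sum of the increments along the walk started at \<open>v\<close>, already
  telescoped.\<close>

definition cocycle :: "nat \<Rightarrow> (nat \<Rightarrow> complex ^ 'd ^ 'd) \<Rightarrow> complex ^ 'd \<Rightarrow> real"
  where "cocycle n x v = ln (norm (rprod x n *v v) / norm v)
    - potential (rprod x n *v v) + potential v - real n * drift"

lemma measurable_rprod:
  assumes "{..<n} \<subseteq> I"
  shows "(\<lambda>x. rprod x n) \<in> borel_measurable (Pi\<^sub>M I (\<lambda>_. \<mu>))"
  using assms
proof (induction n)
  case (Suc n)
  then have [measurable]: "(\<lambda>x. rprod x n) \<in> borel_measurable (Pi\<^sub>M I (\<lambda>_. \<mu>))"
    by (intro Suc.IH) auto
  have [measurable]: "n \<in> I" using Suc.prems by auto
  have "(\<lambda>x. x n) \<in> measurable (Pi\<^sub>M I (\<lambda>_. \<mu>)) \<mu>"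
    by (rule measurable_component_singleton) fact
  then have [measurable]: "(\<lambda>x. x n) \<in> borel_measurable (Pi\<^sub>M I (\<lambda>_. \<mu>))"
    using measurable_ident_mu measurable_compose by blast
  show ?case by simp
qed simp

lemma measurable_cocycle:
  assumes "{..<n} \<subseteq> I"
  shows "(\<lambda>x. cocycle n x v) \<in> borel_measurable (Pi\<^sub>M I (\<lambda>_. \<mu>))"
proof -
  note [measurable] = measurable_rprod[OF assms]
  show ?thesis unfolding cocycle_def by measurable
qed

text \<open>The last factor of \<open>rprod\<close> acts first on \<open>v\<close>. Peeling it off
  leaves a cocycle of length \<open>n\<close> started at \<open>g *v v\<close>.\<close>

lemma cocycle_upd:
  assumes "v \<noteq> 0" "invertible g" "\<And>i. i < n \<Longrightarrow> invertible (x i)"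
  shows "cocycle (Suc n) (x(n := g)) v = cocycle n x (g *v v) + increment v g"
proof -
  have "rprod (x(n := g)) n = rprod x n"
    by (rule rprod_cong) auto
  moreover have "g *v v \<noteq> 0"
    using assms by (simp add: invertible_matrix_vector_eq_0)
  moreover have "rprod x n *v (g *v v) \<noteq> 0"
    using calculation assms by (simp add: invertible_matrix_vector_eq_0 invertible_rprod)
  ultimately show ?thesis
    using assms(1)
    by (simp add: cocycle_def increment_def ln_div matrix_vector_mul_assoc[symmetric] algebra_simps)
qed

text \<open>Fix the last factor \<open>g\<close> and integrate over the first \<open>n\<close>
  coordinates: the induction hypothesis, uniform in the starting vector, applies to
  \<open>g *v v\<close>. The remaining integral over \<open>g\<close> is the one-step bound.\<close>

lemma nn_integral_exp_cocycle_finite: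
  assumes "v \<noteq> 0"
  shows "(\<integral>\<^sup>+ x. ennreal (exp (l * cocycle n x v)) \<partial>Pi\<^sub>M {..<n} (\<lambda>_. \<mu>))
    \<le> ennreal (exp (real n * (l\<^sup>2 * (\<kappa> + c)\<^sup>2 / 2)))"
  using assms
proof (induction n arbitrary: v)
  case 0
  interpret P0: prob_space "Pi\<^sub>M {..<0 :: nat} (\<lambda>_. \<mu>)"
    by (rule prob_space_PiM) (rule prob_space_axioms)
  show ?case using P0.emeasure_space_1 by (simp add: cocycle_def 0)
next
  case (Suc n)
  let ?E = "l\<^sup>2 * (\<kappa> + c)\<^sup>2 / 2"
  have sub: "{..<n} \<subseteq> insert n {..<n}" by auto
  have "(\<integral>\<^sup>+ x. ennreal (exp (l * cocycle (Suc n) x v)) \<partial>Pi\<^sub>M {..<Suc n} (\<lambda>_. \<mu>)) =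
      (\<integral>\<^sup>+ g. (\<integral>\<^sup>+ x. ennreal (exp (l * cocycle (Suc n) (x(n := g)) v)) \<partial>Pi\<^sub>M {..<n} (\<lambda>_. \<mu>)) \<partial>\<mu>)"
    unfolding lessThan_Suc
  proof (rule P.product_nn_integral_insert_rev)
    have [measurable]: "(\<lambda>x. cocycle (Suc n) x v) \<in> borel_measurable (Pi\<^sub>M (insert n {..<n}) (\<lambda>_. \<mu>))"
      by (rule measurable_cocycle) auto
    show "(\<lambda>x. ennreal (exp (l * cocycle (Suc n) x v))) \<in> borel_measurable (Pi\<^sub>M (insert n {..<n}) (\<lambda>_. \<mu>))"
      by measurable
  qed auto
  also have "\<dots> = (\<integral>\<^sup>+ g. (\<integral>\<^sup>+ x. ennreal (exp (l * increment v g)) * ennreal (exp (l * cocycle n x (g *v v)))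
      \<partial>Pi\<^sub>M {..<n} (\<lambda>_. \<mu>)) \<partial>\<mu>)"
  proof (intro nn_integral_cong)
    fix g x assume "g \<in> space \<mu>" "x \<in> space (Pi\<^sub>M {..<n} (\<lambda>_. \<mu>))"
    then have "cocycle (Suc n) (x(n := g)) v = cocycle n x (g *v v) + increment v g"
      using Suc.prems by (intro cocycle_upd) (auto simp: space_mu space_PiM PiE_def Pi_def)
    then show "ennreal (exp (l * cocycle (Suc n) (x(n := g)) v)) =
        ennreal (exp (l * increment v g)) * ennreal (exp (l * cocycle n x (g *v v)))"
      by (simp add: distrib_left exp_add mult.commute flip: ennreal_mult)
  qed
  also have "\<dots> = (\<integral>\<^sup>+ g. ennreal (exp (l * increment v g)) *
      (\<integral>\<^sup>+ x. ennreal (exp (l * cocycle n x (g *v v))) \<partial>Pi\<^sub>M {..<n} (\<lambda>_. \<mu>)) \<partial>\<mu>)"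
    using measurable_cocycle[of n "{..<n}"] by (intro nn_integral_cong nn_integral_cmult) auto
  also have "\<dots> \<le> (\<integral>\<^sup>+ g. ennreal (exp (l * increment v g)) * ennreal (exp (real n * ?E)) \<partial>\<mu>)"
    using Suc by (intro nn_integral_mono mult_left_mono Suc.IH)
       (auto simp: space_mu invertible_matrix_vector_eq_0)
  also have "\<dots> = (\<integral>\<^sup>+ g. ennreal (exp (l * increment v g)) \<partial>\<mu>) * ennreal (exp (real n * ?E))"
    by (rule nn_integral_multc) measurable
  also have "\<dots> \<le> ennreal (exp ?E) * ennreal (exp (real n * ?E))"
    by (intro mult_right_mono nn_integral_exp_increment Suc.prems) auto
  also have "\<dots> = ennreal (exp (real (Suc n) * ?E))"
    by (simp only: ennreal_mult[symmetric] exp_ge_zero exp_add[symmetric]) (simp add: algebra_simps)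
  finally show ?case .
qed

text \<open>The cocycle depends only on the first \<open>n\<close> coordinates, so the infinite
  product may be replaced by its finite marginal.\<close>

lemma nn_integral_exp_cocycle:
  assumes "v \<noteq> 0"
  shows "(\<integral>\<^sup>+ x. ennreal (exp (l * cocycle n x v)) \<partial>Pi\<^sub>M UNIV (\<lambda>_. \<mu>))
    \<le> ennreal (exp (real n * (l\<^sup>2 * (\<kappa> + c)\<^sup>2 / 2)))"
proof -
  note [measurable] = measurable_cocycle[of n "{..<n}", OF subset_refl]
  have restr: "rprod (restrict x {..<n}) n = rprod x n" for x :: "nat \<Rightarrow> complex ^ 'd ^ 'd"
    by (rule rprod_cong) auto
  have "(\<integral>\<^sup>+ x. ennreal (exp (l * cocycle n x v)) \<partial>Pi\<^sub>M UNIV (\<lambda>_. \<mu>)) =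
      (\<integral>\<^sup>+ x. ennreal (exp (l * cocycle n x v)) \<partial>distr (Pi\<^sub>M UNIV (\<lambda>_. \<mu>)) (Pi\<^sub>M {..<n} (\<lambda>_. \<mu>)) (\<lambda>x. restrict x {..<n}))"
    by (subst nn_integral_distr) (simp_all add: measurable_restrict_subset, simp add: cocycle_def restr)
  then show ?thesis
    using nn_integral_exp_cocycle_finite[OF assms] by (simp add: P.distr_PiM_restrict_finite)
qed

text \<open>This is Chernoff's bound, with the sign \<open>e\<close> covering both tails. Working
  with any positive \<open>K\<close> above \<open>\<kappa> + c\<close> avoids dividing by zero when
  both constants vanish.\<close>

lemma prob_cocycle_ge:
  assumes v: "v \<noteq> 0" and K: "0 < K" "\<kappa> + c \<le> K" and s: "0 \<le> s" and e: "\<bar>e\<bar> = 1"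
  shows "measure (Pi\<^sub>M UNIV (\<lambda>_. \<mu>)) {x \<in> space (Pi\<^sub>M UNIV (\<lambda>_. \<mu>)). real n * s \<le> e * cocycle n x v}
    \<le> exp (- (real n * s\<^sup>2 / (2 * K\<^sup>2)))" (is "measure ?P ?A \<le> _")
proof -
  note [measurable] = measurable_cocycle[of n UNIV, OF subset_UNIV]
  \<comment> \<open>This \<open>l\<close> minimises
    \<open>l\<^sup>2 * K\<^sup>2 / 2 - l * s\<close>.\<close>
  define l where "l = s / K\<^sup>2"
  have l: "0 \<le> l" using s by (simp add: l_def)
  have e2: "e\<^sup>2 = 1" using e by (metis one_power2 power2_abs)
  have "emeasure ?P ?A = (\<integral>\<^sup>+ x. indicator ?A x \<partial>?P)"
    by (subst nn_integral_indicator) auto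
  also have "\<dots> \<le> (\<integral>\<^sup>+ x. ennreal (exp (- (l * (real n * s)))) * ennreal (exp ((l * e) * cocycle n x v)) \<partial>?P)"
  proof (intro nn_integral_mono)
    fix x
    show "indicator ?A x \<le> ennreal (exp (- (l * (real n * s)))) * ennreal (exp ((l * e) * cocycle n x v))"
    proof (cases "x \<in> ?A")
      case True
      then have "l * (real n * s) \<le> l * (e * cocycle n x v)"
        using l by (intro mult_left_mono) auto
      then show ?thesis
        using True by (simp add: mult.assoc flip: ennreal_mult exp_add ennreal_1)
    qed simp
  qed
  also have "\<dots> = ennreal (exp (- (l * (real n * s)))) * (\<integral>\<^sup>+ x. ennreal (exp ((l * e) * cocycle n x v)) \<partial>?P)"
    by (rule nn_integral_cmult) measurable
  also have "\<dots> \<le> ennreal (exp (- (l * (real n * s)))) * ennreal (exp (real n * ((l * e)\<^sup>2 * (\<kappa> + c)\<^sup>2 / 2)))"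
    by (intro mult_left_mono nn_integral_exp_cocycle v) auto
  also have "\<dots> \<le> ennreal (exp (- (real n * s\<^sup>2 / (2 * K\<^sup>2))))"
  proof -
    have "l\<^sup>2 * (\<kappa> + c)\<^sup>2 \<le> l\<^sup>2 * K\<^sup>2"
      using K kappa_nonneg c_nonneg by (intro mult_left_mono power_mono) auto
    also have "l\<^sup>2 * K\<^sup>2 = s\<^sup>2 / K\<^sup>2"
      using K by (simp add: l_def power_divide power2_eq_square)
    finally have "real n * (l\<^sup>2 * (\<kappa> + c)\<^sup>2 / 2) \<le> real n * (s\<^sup>2 / K\<^sup>2 / 2)"
      by (intro mult_left_mono) auto
    moreover have "l * (real n * s) = real n * (s\<^sup>2 / K\<^sup>2)"
      by (simp add: l_def power2_eq_square)
    ultimately have "- (l * (real n * s)) + real n * ((l * e)\<^sup>2 * (\<kappa> + c)\<^sup>2 / 2) \<le> - (real n * s\<^sup>2 / (2 * K\<^sup>2))"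
      by (simp add: power_mult_distrib e2 field_simps)
    then show ?thesis by (simp flip: ennreal_mult exp_add)
  qed
  finally show ?thesis
    by (simp add: P.emeasure_eq_measure)
qed

text \<open>The two potential terms differ by at most \<open>K\<close>. If \<open>real n * t\<close>
  is at least \<open>2 * K\<close>, this costs at most half of the deviation, and
  \<open>prob_cocycle_ge\<close> applies at level \<open>t / 2\<close>. Otherwise the exponent is at
  least \<open>- 1 / 8\<close> and the right-hand side exceeds 1.\<close>

lemma prob_ln_norm_ratio:
  assumes v: "v \<noteq> 0" and K: "0 < K" "\<kappa> + c \<le> K" and t: "0 < t"
  shows "measure (Pi\<^sub>M UNIV (\<lambda>_. \<mu>)) {x \<in> space (Pi\<^sub>M UNIV (\<lambda>_. \<mu>)).
      real n * t \<le> \<bar>ln (norm (rprod x n *v v) / norm v) - real n * drift\<bar>}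
    \<le> 2 * exp (- (real n * t\<^sup>2 / (32 * K\<^sup>2)))" (is "measure ?P ?A \<le> _")
proof (cases "real n * t < 2 * K")
  case True
  have "real n * t\<^sup>2 \<le> (real n * t)\<^sup>2"
    unfolding power_mult_distrib
    by (intro mult_right_mono) (cases n, auto simp: power2_eq_square)
  also have "\<dots> \<le> (2 * K)\<^sup>2"
    using True t by (intro power_mono) auto
  finally have "real n * t\<^sup>2 / (32 * K\<^sup>2) \<le> 1 / 8"
    using K by (simp add: field_simps power2_eq_square)
  then have "1 - 1 / 8 \<le> exp (- (real n * t\<^sup>2 / (32 * K\<^sup>2)))"
    using exp_ge_add_one_self[of "- (real n * t\<^sup>2 / (32 * K\<^sup>2))"] by linarith
  then show ?thesis
    using P.prob_le_1[of ?A] by linarith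
next
  case False
  note [measurable] = measurable_cocycle[of n UNIV, OF subset_UNIV]
  let ?B = "\<lambda>e. {x \<in> space ?P. real n * (t / 2) \<le> e * cocycle n x v}"
  have "?A \<subseteq> ?B 1 \<union> ?B (- 1)"
  proof
    fix x assume x: "x \<in> ?A"
    then have "rprod x n *v v \<noteq> 0"
      using v by (subst invertible_matrix_vector_eq_0)
        (auto intro!: invertible_rprod simp: space_PiM space_mu PiE_def Pi_def)
    from nn_integral_log_angle(2)[OF this] nn_integral_log_angle(2)[OF v]
      potential_nonneg[of v] potential_nonneg[of "rprod x n *v v"]
    have "\<bar>cocycle n x v - (ln (norm (rprod x n *v v) / norm v) - real n * drift)\<bar> \<le> K"
      using K kappa_nonneg unfolding cocycle_def by linarith
    then show "x \<in> ?B 1 \<union> ?B (- 1)"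
      using x False by (simp add: abs_le_iff) linarith
  qed
  then have "measure ?P ?A \<le> measure ?P (?B 1 \<union> ?B (- 1))"
    by (intro P.finite_measure_mono) measurable
  also have "\<dots> \<le> measure ?P (?B 1) + measure ?P (?B (- 1))"
    by (intro measure_Un_le) measurable
  also have "\<dots> \<le> 2 * exp (- (real n * (t / 2)\<^sup>2 / (2 * K\<^sup>2)))"
    using prob_cocycle_ge[OF v K, of "t / 2" 1 n] prob_cocycle_ge[OF v K, of "t / 2" "- 1" n] t by simp
  also have "\<dots> \<le> 2 * exp (- (real n * t\<^sup>2 / (32 * K\<^sup>2)))"
    using K by (simp add: power_divide field_simps)
  finally show ?thesis .
qed

text \<open>If all basis vectors deviate by less than \<open>real n * (t / 2)\<close>, then
  \<open>opnorm_le_basis\<close> adds at most \<open>ln (real CARD('d)) / 2\<close>, itself at most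
  \<open>real n * (t / 2)\<close>. Halving \<open>t\<close> turns 32 into 128, and the union bound
  gives the factor \<open>CARD('d)\<close>.\<close>

lemma prob_ln_opnorm:
  assumes K: "0 < K" "\<kappa> + c \<le> K" and t: "0 < t" and n: "ln (real CARD('d)) \<le> real n * t"
  shows "measure (Pi\<^sub>M UNIV (\<lambda>_. \<mu>)) {x \<in> space (Pi\<^sub>M UNIV (\<lambda>_. \<mu>)).
      real n * t \<le> \<bar>ln (opnorm (rprod x n)) - real n * drift\<bar>}
    \<le> 2 * real CARD('d) * exp (- (real n * t\<^sup>2 / (128 * K\<^sup>2)))" (is "measure ?P ?A \<le> _")
proof -
  note [measurable] = measurable_rprod[of n UNIV, OF subset_UNIV]
  let ?e = "\<lambda>i :: 'd. axis i 1 :: complex ^ 'd"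
  let ?B = "\<lambda>i. {x \<in> space ?P. real n * (t / 2) \<le> \<bar>ln (norm (rprod x n *v ?e i) / norm (?e i)) - real n * drift\<bar>}"
  have e: "norm (?e i) = 1" "?e i \<noteq> 0" for i
    by (simp_all add: norm_axis_1 axis_eq_0_iff)
  have "?A \<subseteq> (\<Union>i\<in>UNIV. ?B i)"
  proof
    fix x assume x: "x \<in> ?A"
    let ?R = "rprod x n"
    have pos: "0 < norm (?R *v ?e i)" for i
      unfolding zero_less_norm_iff using x e(2)[of i]
      by (subst invertible_matrix_vector_eq_0)
        (auto intro!: invertible_rprod simp: space_PiM space_mu PiE_def Pi_def)
    have le: "norm (?R *v ?e i) \<le> opnorm ?R" for i
      using norm_matrix_vector_le[of ?R "?e i"] e by simp
    have posR: "0 < opnorm ?R" using pos le order_less_le_trans by blast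
    show "x \<in> (\<Union>i\<in>UNIV. ?B i)"
    proof (rule ccontr)
      assume "x \<notin> (\<Union>i\<in>UNIV. ?B i)"
      then have small: "\<bar>ln (norm (?R *v ?e i)) - real n * drift\<bar> < real n * (t / 2)" for i
        using x e by (auto simp: not_le)
      have less: "norm (?R *v ?e i) < exp (real n * drift + real n * (t / 2))" for i
      proof -
        have "ln (norm (?R *v ?e i)) < real n * drift + real n * (t / 2)"
          using small[of i] by linarith
        then show ?thesis
          using pos[of i] by (metis exp_less_cancel_iff exp_ln)
      qed
      \<comment> \<open>A maximum over finitely many vectors retains the strict inequality.\<close>
      define C where "C = Max (range (\<lambda>i. norm (?R *v ?e i)))"
      have "C \<in> range (\<lambda>i. norm (?R *v ?e i))"
        unfolding C_def by (rule Max_in) auto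
      then have "C < exp (real n * drift + real n * (t / 2))"
        using less by auto
      moreover have "opnorm ?R \<le> sqrt (real CARD('d)) * C"
        by (rule opnorm_le_basis) (simp add: C_def)
      moreover have "0 < sqrt (real CARD('d))"
        by (simp add: zero_less_card_finite)
      ultimately have "opnorm ?R < sqrt (real CARD('d)) * exp (real n * drift + real n * (t / 2))"
        by (meson mult_strict_left_mono order_le_less_trans)
      then have "ln (opnorm ?R) < ln (sqrt (real CARD('d)) * exp (real n * drift + real n * (t / 2)))"
        using posR by simp
      then have "ln (opnorm ?R) < ln (real CARD('d)) / 2 + (real n * drift + real n * (t / 2))"
        by (simp add: ln_mult ln_sqrt)
      then have up: "ln (opnorm ?R) - real n * drift < real n * t"
        using n by simp
      \<comment> \<open>A single basis vector suffices for the lower bound; \<open>undefined\<close>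
        serves as an arbitrary index.\<close>
      have "ln (norm (?R *v ?e undefined)) \<le> ln (opnorm ?R)"
        using le pos posR by simp
      then have "- (real n * t) < ln (opnorm ?R) - real n * drift"
        using small[of undefined] t by (smt (verit) mult_left_mono of_nat_0_le_iff field_sum_of_halves)
      then show False using up x by auto
    qed
  qed
  then have "measure ?P ?A \<le> measure ?P (\<Union>i\<in>UNIV. ?B i)"
    by (intro P.finite_measure_mono) measurable
  also have "\<dots> \<le> (\<Sum>i\<in>UNIV. measure ?P (?B i))"
    by (intro P.finite_measure_subadditive_finite) (auto, measurable)
  also have "\<dots> \<le> (\<Sum>i\<in>(UNIV :: 'd set). 2 * exp (- (real n * (t / 2)\<^sup>2 / (32 * K\<^sup>2))))"
    using t by (intro sum_mono prob_ln_norm_ratio e K) auto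
  also have "\<dots> = 2 * real CARD('d) * exp (- (real n * t\<^sup>2 / (128 * K\<^sup>2)))"
    by (simp add: power_divide)
  finally show ?thesis .
qed

section \<open>Identification of the Lyapunov exponent\<close>

text \<open>For fixed \<open>t\<close> the tail bounds are eventually dominated by a geometric
  sequence, so Borel-Cantelli applies. Taking \<open>t = 1 / real (Suc m)\<close> leaves countably
  many null sets and gives convergence.\<close>

lemma AE_ln_opnorm_tendsto:
  "AE x in Pi\<^sub>M (UNIV :: nat set) (\<lambda>_. \<mu>). (\<lambda>n. ln (opnorm (rprod x n)) / real n) \<longlonglongrightarrow> drift"
proof -
  let ?P = "Pi\<^sub>M (UNIV :: nat set) (\<lambda>_. \<mu>)"
  define K where "K = \<kappa> + c + 1"
  have K: "0 < K" "\<kappa> + c \<le> K"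
    using kappa_nonneg c_nonneg by (auto simp: K_def)
  note measurable_rprod[OF subset_UNIV, measurable]
  let ?A = "\<lambda>t n. {x \<in> space ?P. real n * t \<le> \<bar>ln (opnorm (rprod x n)) - real n * drift\<bar>}"
  have ae: "AE x in ?P. eventually (\<lambda>n. x \<in> space ?P - ?A t n) sequentially" if t: "0 < t" for t
  proof (rule borel_cantelli_AE1)
    define q where "q = exp (- (t\<^sup>2 / (128 * K\<^sup>2)))"
    have q: "0 \<le> q" "q < 1"
      using t K by (auto simp: q_def)
    obtain N :: nat where "ln (real CARD('d)) / t \<le> real N"
      using real_arch_simple by blast
    then have N: "ln (real CARD('d)) \<le> real n * t" if "N \<le> n" for n
      using order_trans[OF \<open>_ \<le> real N\<close>, of "real n"] that t by (simp add: pos_divide_le_eq)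
    have le: "norm (measure ?P (?A t n)) \<le> 2 * real CARD('d) * q ^ n" if "N \<le> n" for n
      using prob_ln_opnorm[OF K t N[OF that]]
      unfolding q_def exp_of_nat_mult[symmetric] by simp
    show "summable (\<lambda>n. measure ?P (?A t n))"
    proof (rule summable_comparison_test'[OF _ le])
      show "summable (\<lambda>n. 2 * real CARD('d) * q ^ n)"
        using q by (intro summable_mult summable_geometric) simp
    qed
    show "?A t n \<in> sets ?P" for n by measurable
    show "emeasure ?P (?A t n) < \<infinity>" for n
      by (simp add: P.emeasure_eq_measure)
  qed
  have "AE x in ?P. \<forall>m. eventually (\<lambda>n. x \<in> space ?P - ?A (1 / real (Suc m)) n) sequentially"
    unfolding AE_all_countable by (intro allI ae) simp
  then show ?thesis
  proof eventually_elim
    case (elim x)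
    show ?case
    proof (rule tendstoI)
      fix e :: real assume "0 < e"
      then obtain m where m: "1 / real (Suc m) < e"
        using nat_approx_posE by blast
      show "\<forall>\<^sub>F n in sequentially. dist (ln (opnorm (rprod x n)) / real n) drift < e"
        using elim[rule_format, of m] eventually_gt_at_top[of 0]
      proof eventually_elim
        case (elim n)
        have "\<bar>ln (opnorm (rprod x n)) - real n * drift\<bar> < real n * (1 / real (Suc m))"
          using elim(1) by (simp only: Diff_iff mem_Collect_eq) linarith
        also have "\<dots> \<le> real n * e"
          using m by (intro mult_left_mono) auto
        finally have "\<bar>ln (opnorm (rprod x n)) - real n * drift\<bar> / real n < e"
          using elim(2) by (simp add: field_simps)
        moreover have "ln (opnorm (rprod x n)) / real n - drift = (ln (opnorm (rprod x n)) - real n * drift) / real n"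
          using elim(2) by (simp add: field_simps)
        ultimately show ?case by (simp add: dist_real_def abs_divide)
      qed
    qed
  qed
qed

lemma lyapunov_eq_drift: "lyapunov \<mu> = drift"
  unfolding lyapunov_def
proof (rule the_equality)
  show "AE x in Pi\<^sub>M (UNIV :: nat set) (\<lambda>_. \<mu>). (\<lambda>n. ln (opnorm (rprod x n)) / real n) \<longlonglongrightarrow> drift"
    by (rule AE_ln_opnorm_tendsto)
next
  fix l assume "AE x in Pi\<^sub>M (UNIV :: nat set) (\<lambda>_. \<mu>). (\<lambda>n. ln (opnorm (rprod x n)) / real n) \<longlonglongrightarrow> l"
  with AE_ln_opnorm_tendsto have "AE x in Pi\<^sub>M (UNIV :: nat set) (\<lambda>_. \<mu>). l = drift"
    by eventually_elim (rule LIMSEQ_unique)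
  then show "l = drift" by (simp add: P.AE_False split: if_splits)
qed

end

section \<open>The support\<close>

text \<open>A point outside the support has a null basic open neighbourhood. A countable basis
  provides only countably many of these, so their union is null.\<close>

lemma AE_support:
  fixes \<mu> :: "(complex ^ 'd ^ 'd) measure"
  assumes sets: "sets \<mu> = sets GL"
  shows "AE g in \<mu>. g \<in> support \<mu>"
proof -
  obtain B :: "(complex ^ 'd ^ 'd) set set" where B: "countable B" "topological_basis B"
    using ex_countable_basis by blast
  let ?N = "\<Union>b\<in>{b \<in> B. emeasure \<mu> (b \<inter> space \<mu>) = 0}. b \<inter> space \<mu>"
  have id: "(\<lambda>g. g) \<in> borel_measurable \<mu>"
    using measurable_ident_GL by (simp add: measurable_cong_sets[OF sets refl])
  have meas: "b \<inter> space \<mu> \<in> sets \<mu>" if "b \<in> B" for b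
    using measurable_sets[OF id, of b] topological_basis_open[OF B(2) that] by auto
  have "?N \<in> null_sets \<mu>"
    using B(1) meas by (intro null_sets_UN') auto
  moreover have "g \<in> ?N" if g: "g \<in> space \<mu>" "g \<notin> support \<mu>" for g
  proof -
    obtain U where U: "open U" "g \<in> U" "emeasure \<mu> (U \<inter> space \<mu>) = 0"
      using g by (auto simp: support_def)
    obtain b where b: "b \<in> B" "g \<in> b" "b \<subseteq> U"
      using topological_basisE[OF B(2) U(1,2)] by blast
    have "U \<inter> space \<mu> \<in> sets \<mu>"
      using measurable_sets[OF id, of U] U(1) by auto
    then have "emeasure \<mu> (b \<inter> space \<mu>) \<le> 0"
      using b emeasure_mono[of "b \<inter> space \<mu>" "U \<inter> space \<mu>" \<mu>] U(3) by auto
    then show ?thesis using b g by auto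
  qed
  ultimately show ?thesis by (intro AE_I') auto
qed

lemma norm_bounds_of_kappa:
  assumes k: "kappa S = ennreal \<kappa>" "0 \<le> \<kappa>" and g: "g \<in> S" "invertible g"
  shows "norm (g *v v) \<le> exp \<kappa> * norm v" and "norm v \<le> exp \<kappa> * norm (g *v v)"
proof -
  have "ennreal (max (ln (opnorm g)) (ln (opnorm (matrix_inv g)))) \<le> ennreal \<kappa>"
    unfolding k(1)[symmetric] kappa_def using g(1) by (rule SUP_upper)
  then have "ln (opnorm g) \<le> \<kappa>" "ln (opnorm (matrix_inv g)) \<le> \<kappa>"
    using k(2) by simp_all
  \<comment> \<open>For \<open>y \<le> 0\<close> the bound holds because the exponential is
    positive.\<close>
  moreover have "y \<le> exp \<kappa>" if "ln y \<le> \<kappa>" for y :: real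
    using that by (metis exp_ge_zero exp_le_cancel_iff exp_ln linorder_not_less order_trans)
  ultimately have le: "opnorm g \<le> exp \<kappa>" "opnorm (matrix_inv g) \<le> exp \<kappa>"
    by auto
  show "norm (g *v v) \<le> exp \<kappa> * norm v"
    by (rule order_trans[OF norm_matrix_vector_le mult_right_mono[OF le(1)]]) simp
  have "matrix_inv g ** g = mat 1"
    using someI_ex[OF g(2)[unfolded invertible_def]] unfolding matrix_inv_def by blast
  then have "norm v = norm (matrix_inv g *v (g *v v))"
    by (simp add: matrix_vector_mul_assoc)
  also have "\<dots> \<le> exp \<kappa> * norm (g *v v)"
    by (rule order_trans[OF norm_matrix_vector_le mult_right_mono[OF le(2)]]) simp
  finally show "norm v \<le> exp \<kappa> * norm (g *v v)" .
qed

section \<open>Extended-real bounds and transfer to arbitrary i.i.d. sequences\<close>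

text \<open>For positive \<open>K\<^sub>0\<close> take \<open>K = K\<^sub>0\<close>. If
  \<open>K\<^sub>0 = 0\<close> and \<open>a > 0\<close>, letting \<open>K\<close> tend to 0 forces
  \<open>p \<le> 0\<close>, matching \<open>exp_neg\<close> at \<infinity>. If both vanish, the
  quotient 0/0 is 0 in \<open>ennreal\<close> and the bound is just \<open>C\<close>.\<close>

lemma le_exp_neg:
  fixes p C a k K\<^sub>0 :: real
  assumes bound: "\<And>K. 0 < K \<Longrightarrow> K\<^sub>0 \<le> K \<Longrightarrow> p \<le> C * exp (- (a / (k * K\<^sup>2)))"
    and nonneg: "0 \<le> a" "0 < k" "0 \<le> K\<^sub>0"
  shows "p \<le> C * exp_neg (ennreal a / (ennreal k * (ennreal K\<^sub>0)\<^sup>2))"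
proof (cases "K\<^sub>0 = 0")
  case False
  then have "ennreal a / (ennreal k * (ennreal K\<^sub>0)\<^sup>2) = ennreal (a / (k * K\<^sub>0\<^sup>2))"
    using nonneg by (simp add: ennreal_power divide_ennreal flip: ennreal_mult)
  then show ?thesis
    using bound[of K\<^sub>0] False nonneg by (simp add: exp_neg_def)
next
  case True
  show ?thesis
  proof (cases "a = 0")
    case True
    then show ?thesis
      using bound[of "K\<^sub>0 + 1"] nonneg by (simp add: exp_neg_def)
  next
    case False
    define q where "q = exp (- (a / k))"
    have q: "0 \<le> q" "q < 1" using nonneg False by (auto simp: q_def)
    \<comment> \<open>With \<open>K = 1 / sqrt (real (Suc m))\<close>, the factor
      \<open>1 / K\<^sup>2\<close> is \<open>Suc m\<close>, so the exponential becomes a power of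
      \<open>q\<close>.\<close>
    have "p \<le> C * q ^ Suc m" for m
      using bound[of "1 / sqrt (real (Suc m))"] True
      by (simp add: q_def power_divide exp_of_nat_mult[symmetric] mult.commute del: of_nat_Suc power_Suc)
    moreover have "(\<lambda>m. C * q ^ Suc m) \<longlonglongrightarrow> C * 0"
      using q by (intro tendsto_mult_left LIMSEQ_Suc LIMSEQ_realpow_zero)
    ultimately have "p \<le> 0"
      using LIMSEQ_le_const by fastforce
    then show ?thesis
      using True False nonneg by (simp add: exp_neg_def ennreal_divide_zero)
  qed
qed

theorem proposition1p13:
  fixes \<mu> :: "(complex ^ 'd ^ 'd) measure"
    and \<nu> :: "(complex ^ 'd) set measure"
    and M :: "'a measure"
    and X :: "nat \<Rightarrow> 'a \<Rightarrow> complex ^ 'd ^ 'd"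
    and R :: "nat \<Rightarrow> 'a \<Rightarrow> complex ^ 'd ^ 'd"
  assumes "prob_space \<mu>" and "sets \<mu> = sets GL"
    and "boundedly_supported \<mu>"
    and "strongly_irreducible (semigroup_gen (support \<mu>))"
    and "proximal (semigroup_gen (support \<mu>))"
    and "stationary (adjoint_measure \<mu>) \<nu>"
    and "prob_space M"
    and "prob_space.indep_vars M (\<lambda>_. \<mu>) X UNIV"
    and "\<And>i. distr M \<mu> (X i) = \<mu>"
    and "\<And>n \<omega>. R n \<omega> = rprod (\<lambda>i. X i \<omega>) n"
  shows "(\<forall>t>0. \<forall>n.
            (SUP v \<in> - {0}. measure M {\<omega> \<in> space M.
                \<bar>ln (norm (R n \<omega> *v v) / norm v) - real n * lyapunov \<mu>\<bar> \<ge> real n * t})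
            \<le> 2 * exp_neg (ennreal (real n * t\<^sup>2) / (32 * (kappa (support \<mu>) + cfrak \<nu>)\<^sup>2)))
       \<and> (\<forall>t>0. \<forall>n. real n * t \<ge> ln (real CARD('d)) \<longrightarrow>
            measure M {\<omega> \<in> space M.
                \<bar>ln (opnorm (R n \<omega>)) - real n * lyapunov \<mu>\<bar> \<ge> real n * t}
            \<le> 2 * real CARD('d) *
               exp_neg (ennreal (real n * t\<^sup>2) / (128 * (kappa (support \<mu>) + cfrak \<nu>)\<^sup>2)))"
proof -
  interpret M: prob_space M by fact
  \<comment> \<open>The supremum is taken in the reals, so bounding it requires a nonempty index
    set.\<close>
  have ne: "- {0} \<noteq> ({} :: (complex ^ 'd) set)"
    using axis_eq_0_iff[of undefined "1 :: complex"] by blast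
  show ?thesis
  proof (cases "cfrak \<nu> = \<infinity>")
    case True
    \<comment> \<open>An infinite denominator makes the quotient 0 and \<open>exp_neg\<close> equal
      to 1; the claimed bounds are then at least 2.\<close>
    have trivial: "exp_neg (ennreal a / (b * (kappa (support \<mu>) + cfrak \<nu>)\<^sup>2)) = 1" if "b \<noteq> 0" for a b
      using True that by (simp add: exp_neg_def ennreal_mult_top power2_eq_square)
    have card: "1 \<le> real CARD('d)"
      by (simp add: Suc_leI zero_less_card_finite)
    have "(SUP v \<in> - {0}. measure M (A v)) \<le> 2" for A :: "complex ^ 'd \<Rightarrow> 'a set"
      by (rule cSUP_least[OF ne]) (rule order_trans[OF M.prob_le_1], simp)
    moreover have "measure M A \<le> 2 * real CARD('d)" for A
      using M.prob_le_1[of A] card by linarith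
    ultimately show ?thesis
      by (simp add: trivial)
  next
    case False
    define \<kappa> where "\<kappa> = enn2real (kappa (support \<mu>))"
    define c where "c = enn2real (cfrak \<nu>)"
    have \<kappa>: "kappa (support \<mu>) = ennreal \<kappa>" "0 \<le> \<kappa>"
      using assms(3) by (auto simp: \<kappa>_def boundedly_supported_def)
    have c: "cfrak \<nu> = ennreal c" "0 \<le> c"
      using False by (auto simp: c_def less_top)
    have sum: "kappa (support \<mu>) + cfrak \<nu> = ennreal (\<kappa> + c)"
      using \<kappa> c by simp
    interpret walk: matrix_walk \<mu> \<nu> \<kappa> c
    proof (intro matrix_walk.intro matrix_walk_axioms.intro assms \<kappa> c)
      show "AE g in \<mu>. \<forall>v. norm (g *v v) \<le> exp \<kappa> * norm v \<and> norm v \<le> exp \<kappa> * norm (g *v v)"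
        using AE_support[OF assms(2)] AE_space
      proof eventually_elim
        case (elim g)
        then have "invertible g"
          using sets_eq_imp_space_eq[OF assms(2)] by (simp add: space_GL)
        then show ?case
          using norm_bounds_of_kappa[OF \<kappa> elim(1)] by blast
      qed
      show "cfrak \<nu> \<le> ennreal c" using c by simp
    qed
    let ?P = "Pi\<^sub>M (UNIV :: nat set) (\<lambda>_. \<mu>)"
    have X: "X i \<in> measurable M \<mu>" for i
      using assms(8) by (simp add: M.indep_vars_def)
    then have XP: "(\<lambda>\<omega> i. X i \<omega>) \<in> measurable M ?P"
      by (intro measurable_PiM_single') (auto simp: space_PiM dest: measurable_space)
    \<comment> \<open>Independence and the common law make the joint law of the sequence the
      canonical product measure.\<close>
    have distr: "distr M ?P (\<lambda>\<omega> i. X i \<omega>) = ?P"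
      using M.indep_vars_iff_distr_eq_PiM[THEN iffD1, OF UNIV_not_empty X assms(8)]
      by (simp only: assms(9) restrict_UNIV)
    have transfer: "measure M {\<omega> \<in> space M. Q (\<lambda>i. X i \<omega>)} = measure ?P {x \<in> space ?P. Q x}"
      if "{x \<in> space ?P. Q x} \<in> sets ?P" for Q
    proof -
      have "measure ?P {x \<in> space ?P. Q x} =
          measure M ((\<lambda>\<omega> i. X i \<omega>) -` {x \<in> space ?P. Q x} \<inter> space M)"
        using measure_distr[OF XP that] by (simp add: distr)
      also have "(\<lambda>\<omega> i. X i \<omega>) -` {x \<in> space ?P. Q x} \<inter> space M = {\<omega> \<in> space M. Q (\<lambda>i. X i \<omega>)}"
        using measurable_space[OF XP] by auto
      finally show ?thesis by simp
    qed
    note walk.measurable_rprod[OF subset_UNIV, measurable]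
    show ?thesis
    proof (intro conjI allI impI)
      fix t :: real and n :: nat assume t: "0 < t"
      show "(SUP v \<in> - {0}. measure M {\<omega> \<in> space M.
                \<bar>ln (norm (R n \<omega> *v v) / norm v) - real n * lyapunov \<mu>\<bar> \<ge> real n * t})
            \<le> 2 * exp_neg (ennreal (real n * t\<^sup>2) / (32 * (kappa (support \<mu>) + cfrak \<nu>)\<^sup>2))"
      proof (rule cSUP_least[OF ne])
        fix v :: "complex ^ 'd" assume "v \<in> - {0}"
        then have v: "v \<noteq> 0" by simp
        show "measure M {\<omega> \<in> space M.
                \<bar>ln (norm (R n \<omega> *v v) / norm v) - real n * lyapunov \<mu>\<bar> \<ge> real n * t}
            \<le> 2 * exp_neg (ennreal (real n * t\<^sup>2) / (32 * (kappa (support \<mu>) + cfrak \<nu>)\<^sup>2))"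
          unfolding sum assms(10) walk.lyapunov_eq_drift
          using \<kappa>(2) c(2)
          by (subst transfer, measurable)
             (intro le_exp_neg[where k = 32, simplified] walk.prob_ln_norm_ratio v t; simp)
      qed
    next
      fix t :: real and n :: nat assume t: "0 < t" and n: "ln (real CARD('d)) \<le> real n * t"
      show "measure M {\<omega> \<in> space M.
                \<bar>ln (opnorm (R n \<omega>)) - real n * lyapunov \<mu>\<bar> \<ge> real n * t}
            \<le> 2 * real CARD('d) *
               exp_neg (ennreal (real n * t\<^sup>2) / (128 * (kappa (support \<mu>) + cfrak \<nu>)\<^sup>2))"
        unfolding sum assms(10) walk.lyapunov_eq_drift
        using \<kappa>(2) c(2)
        by (subst transfer, measurable)
           (intro le_exp_neg[where k = 128, simplified] walk.prob_ln_opnorm t n; simp)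
    qed
  qed
qed

end
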